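(* For real $X$, let $T(X)$ be the total, over all nonzero integers $m\in[-X,X]$, of the number of $\mathrm{SL}_2(\mathbb{Z}[\frac1m])$-equivalence classes of binary quadratic forms over $\mathbb{Z}[\frac1m]$ of discriminant $1-4m$. Then $\lim_{X\to\infty} T(X)/X^{3/2}=0$.
   Context: A binary quadratic form $ax^2+bxy+cy^2$ over a ring $B$ has discriminant $b^2-4ac$; $\mathrm{SL}_2(B)$ acts by linear change of variables. *)

theory Defs
  imports "HOL-Analysis.Analysis"
begin

text \<open>The triple \<open>(a, b, c)\<close> stands for the form \<open>a x\<^sup>2 + b x y + c y\<^sup>2\<close>. A ground ring \<open>B\<close> is
  given as a subset of an ambient commutative ring.\<close>

type_synonym 'a bqf = "'a \<times> 'a \<times> 'a"

definition bqf_eval :: "'a::comm_ring_1 bqf \<Rightarrow> 'a ^ 2 \<Rightarrow> 'a" where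
  "bqf_eval = (\<lambda>(a, b, c) v. a * (v $ 1)\<^sup>2 + b * (v $ 1) * (v $ 2) + c * (v $ 2)\<^sup>2)"

definition bqf_disc :: "'a::comm_ring_1 bqf \<Rightarrow> 'a" where
  "bqf_disc = (\<lambda>(a, b, c). b\<^sup>2 - 4 * a * c)"

definition bqf_over :: "'a::comm_ring_1 set \<Rightarrow> 'a bqf set" where
  "bqf_over B = B \<times> B \<times> B"

definition SL2 :: "'a::comm_ring_1 set \<Rightarrow> ('a ^ 2 ^ 2) set" where
  "SL2 B = {A. (\<forall>i j. A $ i $ j \<in> B) \<and> det A = 1}"

text \<open>The coefficients of the form obtained by substituting \<open>A *v v\<close> for \<open>v\<close>, see
  \<open>bqf_eval_subst\<close> below. This is a right action; passing to the left action by transposes or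
  inverses does not change the orbits.\<close>

definition bqf_subst :: "'a::comm_ring_1 ^ 2 ^ 2 \<Rightarrow> 'a bqf \<Rightarrow> 'a bqf" where
  "bqf_subst A = (\<lambda>(a, b, c).
     let p = A $ 1 $ 1; q = A $ 1 $ 2; r = A $ 2 $ 1; s = A $ 2 $ 2 in
       (a * p\<^sup>2 + b * p * r + c * r\<^sup>2,
        2 * a * p * q + b * (p * s + q * r) + 2 * c * r * s,
        a * q\<^sup>2 + b * q * s + c * s\<^sup>2))"

lemma bqf_eval_subst: "bqf_eval (bqf_subst A f) v = bqf_eval f (A *v v)"
  by (cases f) (simp add: bqf_eval_def bqf_subst_def Let_def matrix_vector_mult_def sum_2
      power2_eq_square algebra_simps)

lemma bqf_disc_subst: "bqf_disc (bqf_subst A f) = (det A)\<^sup>2 * bqf_disc f"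
  by (cases f) (simp add: bqf_disc_def bqf_subst_def Let_def det_2 power2_eq_square algebra_simps)

lemma bqf_subst_mult: "bqf_subst (A ** A') f = bqf_subst A' (bqf_subst A f)"
  by (cases f) (simp add: bqf_subst_def Let_def matrix_matrix_mult_def sum_2
      power2_eq_square algebra_simps)

lemma bqf_subst_one: "bqf_subst (mat 1) f = f"
  by (cases f) (simp add: bqf_subst_def Let_def mat_def)

definition bqf_of_disc :: "'a::comm_ring_1 set \<Rightarrow> 'a \<Rightarrow> 'a bqf set" where
  "bqf_of_disc B D = {f \<in> bqf_over B. bqf_disc f = D}"

definition SL2_equiv :: "'a::comm_ring_1 set \<Rightarrow> 'a \<Rightarrow> ('a bqf \<times> 'a bqf) set" where
  "SL2_equiv B D = {(f, g). f \<in> bqf_of_disc B D \<and> g \<in> bqf_of_disc B D \<and>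
     (\<exists>A \<in> SL2 B. g = bqf_subst A f)}"

definition SL2_classes :: "'a::comm_ring_1 set \<Rightarrow> 'a \<Rightarrow> 'a bqf set set" where
  "SL2_classes B D = bqf_of_disc B D // SL2_equiv B D"

text \<open>The ring \<open>\<int>[1/m]\<close> inside the rationals, for \<open>m \<noteq> 0\<close>.\<close>

definition Z_inv :: "int \<Rightarrow> rat set" where
  "Z_inv m = {of_int a / of_int m ^ k | a k. True}"

lemma Z_inv_ring:
  assumes "m \<noteq> 0"
  shows "of_int n \<in> Z_inv m" "1 / of_int m \<in> Z_inv m"
    "\<lbrakk>x \<in> Z_inv m; y \<in> Z_inv m\<rbrakk> \<Longrightarrow> x + y \<in> Z_inv m"
    "\<lbrakk>x \<in> Z_inv m; y \<in> Z_inv m\<rbrakk> \<Longrightarrow> x * y \<in> Z_inv m"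
    "x \<in> Z_inv m \<Longrightarrow> - x \<in> Z_inv m"
proof -
  have I: "of_int a / of_int m ^ k \<in> Z_inv m" for a k
    unfolding Z_inv_def by blast
  show "of_int n \<in> Z_inv m" using I[of n 0] by simp
  show "1 / of_int m \<in> Z_inv m" using I[of 1 1] by simp
  show "- x \<in> Z_inv m" if "x \<in> Z_inv m"
  proof -
    from that obtain a k where "x = of_int a / of_int m ^ k" unfolding Z_inv_def by blast
    then show ?thesis using I[of "-a" k] by simp
  qed
  fix x y assume "x \<in> Z_inv m" "y \<in> Z_inv m"
  then obtain a k b l where xy: "x = of_int a / of_int m ^ k" "y = of_int b / of_int m ^ l"
    unfolding Z_inv_def by blast
  have "x + y = of_int (a * m ^ l + b * m ^ k) / of_int m ^ (k + l)"
    using assms by (simp add: xy power_add field_simps)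
  then show "x + y \<in> Z_inv m" using I by metis
  have "x * y = of_int (a * b) / of_int m ^ (k + l)"
    by (simp add: xy power_add)
  then show "x * y \<in> Z_inv m" using I by metis
qed

lemma equiv_SL2_equiv:
  fixes B :: "'a::comm_ring_1 set"
  assumes one: "1 \<in> B" and zero: "0 \<in> B"
    and mult: "\<And>x y. x \<in> B \<Longrightarrow> y \<in> B \<Longrightarrow> x * y \<in> B"
    and add: "\<And>x y. x \<in> B \<Longrightarrow> y \<in> B \<Longrightarrow> x + y \<in> B"
    and neg: "\<And>x. x \<in> B \<Longrightarrow> - x \<in> B"
  shows "equiv (bqf_of_disc B D) (SL2_equiv B D)"
proof (rule equivI)
  show "SL2_equiv B D \<subseteq> bqf_of_disc B D \<times> bqf_of_disc B D"
    by (auto simp: SL2_equiv_def)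
  have "mat 1 \<in> SL2 B" by (simp add: SL2_def) (simp add: mat_def one zero)
  then show "refl_on (bqf_of_disc B D) (SL2_equiv B D)"
    by (auto simp: refl_on_def SL2_equiv_def intro: bqf_subst_one[symmetric])
  show "sym (SL2_equiv B D)"
  proof (rule symI)
    fix f g assume "(f, g) \<in> SL2_equiv B D"
    then obtain A where fg: "f \<in> bqf_of_disc B D" "g \<in> bqf_of_disc B D"
      and A: "A \<in> SL2 B" "g = bqf_subst A f" by (auto simp: SL2_equiv_def)
    define A' :: "'a ^ 2 ^ 2" where "A' = (\<chi> i j.
      if i = 1 then (if j = 1 then A $ 2 $ 2 else - A $ 1 $ 2)
      else (if j = 1 then - A $ 2 $ 1 else A $ 1 $ 1))"
    have A'_in: "A' \<in> SL2 B"
      using A(1) neg by (auto simp: SL2_def A'_def det_2 algebra_simps)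
    have "A ** A' = mat 1"
      using A(1) by (simp add: SL2_def A'_def det_2 vec_eq_iff matrix_matrix_mult_def mat_def
          sum_2 forall_2 algebra_simps)
    then have "f = bqf_subst A' g"
      by (metis A(2) bqf_subst_mult bqf_subst_one)
    then show "(g, f) \<in> SL2_equiv B D" using fg A'_in by (auto simp: SL2_equiv_def)
  qed
  show "trans (SL2_equiv B D)"
  proof (rule transI)
    fix f g h assume "(f, g) \<in> SL2_equiv B D" "(g, h) \<in> SL2_equiv B D"
    then obtain A A' where *: "f \<in> bqf_of_disc B D" "h \<in> bqf_of_disc B D"
      "A \<in> SL2 B" "A' \<in> SL2 B" "h = bqf_subst A' (bqf_subst A f)"
      by (auto simp: SL2_equiv_def)
    have "(A ** A') $ i $ j \<in> B" for i j
      using *(3,4) by (simp add: SL2_def matrix_matrix_mult_def sum_2 add mult)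
    then have "A ** A' \<in> SL2 B"
      using *(3,4) by (simp add: SL2_def det_mul)
    then show "(f, h) \<in> SL2_equiv B D"
      using * by (auto simp: SL2_equiv_def bqf_subst_mult[symmetric])
  qed
qed

text \<open>\<open>card\<close> is \<open>0\<close> on infinite sets, so the value below is the intended one only together with the
  finiteness of all the sets of classes involved.\<close>

definition class_total :: "real \<Rightarrow> nat" where
  "class_total X = (\<Sum>m | m \<noteq> 0 \<and> real_of_int m \<in> {-X..X}.
     card (SL2_classes (Z_inv m) (of_int (1 - 4 * m))))"

end

theory Submission
  imports Defs "HOL-Number_Theory.Cong" "HOL-Computational_Algebra.Primes"
begin

text \<open>Every class over \<open>\<int>[1/m]\<close> contains integral forms; represent it by an integral form \<open>(a, b, c)\<close> with
  \<open>\<bar>a\<bar>\<close> minimal, reduced by translations to \<open>\<bar>b\<bar> \<le> \<bar>a\<bar> \<le> \<bar>c\<bar>\<close>. Counting representatives already gives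
  \<open>O(X\<^bsup>3/2\<^esup>)\<close>, and those with \<open>\<bar>a\<bar> \<le> \<epsilon> \<surd>X\<close> contribute \<open>O(\<epsilon> X\<^bsup>3/2\<^esup>)\<close>. The others lie in a cube of side
  \<open>O(\<surd>X)\<close>, as do all reduced forms of their classes, so it suffices that almost all of these classes
  contain at least \<open>K\<close> forms in the cube. For \<open>m < 0\<close> these are supplied by the steps along Conway's
  river. For \<open>m > 0\<close> with a small prime factor \<open>p\<close> they are the reductions of the forms
  \<open>(p\<^bsup>2k\<^esup> a, b, p\<^bsup>2(K-k)\<^esup> c)\<close>, which are equivalent over \<open>\<int>[1/m]\<close>. In both cases a coincidence would be
  a similarity of small ratio with small entries, which is impossible unless the content is large.
  Forms of large content are rare, and so are, by a sieve and the divergence of the harmonic series,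
  the forms whose \<open>m\<close> has no small prime factor.\<close>

section \<open>Equivalence of integral forms over \<open>\<int>[1/m]\<close>\<close>

text \<open>The crude count of minimal representatives is only bounded by a multiple of
  \<open>X powr (3 / 2)\<close>, so the whole gain must come from one class containing many integral
  forms of bounded size. What makes this work is that \<open>\<bar>a\<bar>\<close> is minimal over
  the entire class over \<open>Z_inv m\<close>, not over an integral class. As
  \<open>(a, b, c)\<close> is equivalent to \<open>(c, -b, a)\<close>, the single inequality
  \<open>\<bar>a\<bar> > \<epsilon> * sqrt X\<close> for the representative bounds BOTH outer
  coefficients of EVERY integral form of the class from below. Together with
  \<open>\<bar>a * c\<bar> = O(X)\<close> this confines the forms produced later to the cube,
  without any estimate of class numbers or fundamental units. \<open>K\<close> is fixed before X
  grows, so losses such as \<open>2 ^ K\<close> or \<open>P ^ (2 * K)\<close> are harmless. Definite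
  forms have only finitely many integral automorphs, hence the recourse to a prime p dividing m:
  modulo p the polynomial \<open>x^2 + x + m\<close> has the distinct roots 0 and -1, so p splits
  and its powers supply new forms. Content is a real obstacle: a large multiple of
  \<open>x^2 + x*y + y^2\<close> or \<open>x^2 + x*y - y^2\<close> has large coefficients and yet
  automorphs with tiny entries.\<close>

lemma Z_inv_power:
  assumes "m \<noteq> 0" "x \<in> Z_inv m"
  shows "x ^ n \<in> Z_inv m"
  using Z_inv_ring(1)[of m 1] Z_inv_ring(4)[of m] assms by (induction n) auto

lemma Z_inv_minus:
  assumes "m \<noteq> 0" "x \<in> Z_inv m" "y \<in> Z_inv m"
  shows "x - y \<in> Z_inv m"
  using Z_inv_ring(3)[of m x "- y"] Z_inv_ring(5)[of m y] assms by simp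

lemma Z_inv_of_int_div: "of_int a / of_int m ^ k \<in> Z_inv m"
  unfolding Z_inv_def by blast

lemma Z_inv_divide_dvd_power:
  assumes "m \<noteq> 0" "u dvd m ^ k"
  shows "of_int a / of_int u \<in> Z_inv m"
proof -
  from assms(2) obtain v where v: "m ^ k = u * v" by blast
  then have uv: "of_int m ^ k = (of_int u * of_int v :: rat)" "u \<noteq> 0" "v \<noteq> 0"
    using assms(1) by (auto simp flip: of_int_mult of_int_power)
  then have "of_int a / of_int u = (of_int (a * v) / of_int m ^ k :: rat)"
    by (simp add: field_simps uv(1))
  then show ?thesis using Z_inv_of_int_div by metis
qed

lemmas Z_inv_closed =
  Z_inv_ring(1,3-5) Z_inv_power Z_inv_minus Z_inv_of_int_div

lemma Z_inv_closed_numeral: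
  assumes "m \<noteq> 0"
  shows "0 \<in> Z_inv m" "1 \<in> Z_inv m" "numeral n \<in> Z_inv m"
  using Z_inv_ring(1)[OF assms, of 0] Z_inv_ring(1)[OF assms, of 1]
    Z_inv_ring(1)[OF assms, of "numeral n"] by simp_all

lemma equiv_Z_inv:
  assumes "m \<noteq> 0"
  shows "equiv (bqf_of_disc (Z_inv m) D) (SL2_equiv (Z_inv m) D)"
  by (rule equiv_SL2_equiv) (use assms in \<open>auto intro: Z_inv_closed Z_inv_closed_numeral\<close>)

lemma SL2_equivI:
  assumes m: "m \<noteq> 0" and f: "(a, b, c) \<in> bqf_of_disc (Z_inv m) D"
    and B: "p \<in> Z_inv m" "q \<in> Z_inv m" "r \<in> Z_inv m" "s \<in> Z_inv m" and det: "p * s - q * r = 1"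
    and g: "a' = a * p\<^sup>2 + b * p * r + c * r\<^sup>2" "b' = 2 * a * p * q + b * (p * s + q * r) + 2 * c * r * s"
      "c' = a * q\<^sup>2 + b * q * s + c * s\<^sup>2"
  shows "((a, b, c), (a', b', c')) \<in> SL2_equiv (Z_inv m) D"
proof -
  define A :: "rat ^ 2 ^ 2" where "A = (\<chi> i j. if i = 1 then (if j = 1 then p else q)
    else (if j = 1 then r else s))"
  have A: "A $ 1 $ 1 = p" "A $ 1 $ 2 = q" "A $ 2 $ 1 = r" "A $ 2 $ 2 = s"
    by (simp_all add: A_def)
  have dA: "det A = 1" by (simp add: det_2 A det)
  have "A \<in> SL2 (Z_inv m)"
    using B dA by (auto simp: SL2_def forall_2 A)
  moreover have eq: "(a', b', c') = bqf_subst A (a, b, c)"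
    by (simp add: bqf_subst_def A Let_def g)
  moreover have "bqf_disc (a', b', c') = D"
    using f by (simp add: eq bqf_disc_subst dA bqf_of_disc_def)
  moreover have "a' \<in> Z_inv m" "b' \<in> Z_inv m" "c' \<in> Z_inv m"
    unfolding g using m B f
    by (auto simp: bqf_of_disc_def bqf_over_def intro!: Z_inv_closed Z_inv_closed_numeral)
  ultimately have "(a', b', c') \<in> bqf_of_disc (Z_inv m) D"
    unfolding bqf_of_disc_def bqf_over_def by blast
  with f \<open>A \<in> SL2 (Z_inv m)\<close> eq show ?thesis
    unfolding SL2_equiv_def by blast
qed

definition rat_bqf :: "int bqf \<Rightarrow> rat bqf" where
  "rat_bqf = (\<lambda>(a, b, c). (of_int a, of_int b, of_int c))"

lemma rat_bqf_simp [simp]: "rat_bqf (a, b, c) = (of_int a, of_int b, of_int c)"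
  by (simp add: rat_bqf_def)

lemma bqf_disc_rat_bqf [simp]: "bqf_disc (rat_bqf f) = of_int (bqf_disc f)"
  by (cases f) (simp add: bqf_disc_def)

lemma rat_bqf_in_iff:
  assumes "m \<noteq> 0"
  shows "rat_bqf f \<in> bqf_of_disc (Z_inv m) (of_int D) \<longleftrightarrow> bqf_disc f = D"
proof -
  have "rat_bqf f \<in> bqf_over (Z_inv m)"
    using assms by (cases f) (auto simp: bqf_over_def intro: Z_inv_ring)
  then show ?thesis by (simp add: bqf_of_disc_def)
qed

text \<open>The forms are integral but the matrices have entries in \<open>Z_inv m\<close>, so one
  class may contain many integral classes. The discriminant condition is built in, hence m can be
  recovered from any related form.\<close>

definition zequiv :: "int \<Rightarrow> int bqf \<Rightarrow> int bqf \<Rightarrow> bool" where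
  "zequiv m f g \<longleftrightarrow> (rat_bqf f, rat_bqf g) \<in> SL2_equiv (Z_inv m) (of_int (1 - 4 * m))"

lemma zequiv_refl: "m \<noteq> 0 \<Longrightarrow> bqf_disc f = 1 - 4 * m \<Longrightarrow> zequiv m f f"
  using equiv_Z_inv[of m] rat_bqf_in_iff[of m f "1 - 4 * m"]
  by (auto simp: zequiv_def equiv_def refl_on_def)

lemma zequiv_sym: "m \<noteq> 0 \<Longrightarrow> zequiv m f g \<Longrightarrow> zequiv m g f"
  using equiv_Z_inv[of m "of_int (1 - 4 * m)"] by (auto simp: zequiv_def equiv_def dest: symD)

lemma zequiv_trans: "m \<noteq> 0 \<Longrightarrow> zequiv m f g \<Longrightarrow> zequiv m g h \<Longrightarrow> zequiv m f h"
  using equiv_Z_inv[of m "of_int (1 - 4 * m)"] unfolding zequiv_def equiv_def by (blast dest: transD)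

lemma zequiv_disc:
  assumes "m \<noteq> 0" "zequiv m f g"
  shows "bqf_disc f = 1 - 4 * m" "bqf_disc g = 1 - 4 * m"
proof -
  have "rat_bqf f \<in> bqf_of_disc (Z_inv m) (of_int (1 - 4 * m))"
       "rat_bqf g \<in> bqf_of_disc (Z_inv m) (of_int (1 - 4 * m))"
    using assms(2) unfolding zequiv_def SL2_equiv_def by auto
  then show "bqf_disc f = 1 - 4 * m" "bqf_disc g = 1 - 4 * m"
    using rat_bqf_in_iff[OF assms(1)] by blast+
qed

lemma zequiv_int:
  fixes p q r s :: int
  assumes m: "m \<noteq> 0" and f: "bqf_disc (a, b, c) = 1 - 4 * m" and det: "p * s - q * r = 1"
    and g: "a' = a * p\<^sup>2 + b * p * r + c * r\<^sup>2" "b' = 2 * a * p * q + b * (p * s + q * r) + 2 * c * r * s"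
      "c' = a * q\<^sup>2 + b * q * s + c * s\<^sup>2"
  shows "zequiv m (a, b, c) (a', b', c')"
proof -
  have "of_int p * of_int s - of_int q * of_int r = (1 :: rat)"
    using det by (metis of_int_1 of_int_diff of_int_mult)
  then show ?thesis
    unfolding zequiv_def rat_bqf_simp
    by (intro SL2_equivI[where p = "of_int p" and q = "of_int q" and r = "of_int r" and s = "of_int s"])
     (use m f det rat_bqf_in_iff[OF m, of "(a, b, c)" "1 - 4 * m"] in
       \<open>simp_all add: g Z_inv_ring\<close>)
qed

text \<open>The matrix is diag(\<open>p^k\<close>, \<open>p^(-k)\<close>), which exists because p is
  a unit of \<open>Z_inv m\<close>. Determinant 1 is the reason for the even exponent.\<close>

lemma zequiv_scale:
  fixes p :: int
  assumes m: "m \<noteq> 0" and f: "bqf_disc (a, b, p ^ (2 * k) * c) = 1 - 4 * m" and p: "p dvd m"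
  shows "zequiv m (a, b, p ^ (2 * k) * c) (p ^ (2 * k) * a, b, c)"
  unfolding zequiv_def rat_bqf_simp
proof (rule SL2_equivI[where p = "of_int p ^ k" and q = 0 and r = 0 and s = "1 / of_int p ^ k"])
  have p0: "p \<noteq> 0" using m p by auto
  have "1 / of_int p ^ k \<in> Z_inv m"
    using Z_inv_divide_dvd_power[OF m, of "p ^ k" k 1] p by (simp add: dvd_power_same)
  then show "1 / of_int p ^ k \<in> Z_inv m" .
  show "of_int p ^ k * (1 / of_int p ^ k) - 0 * 0 = (1::rat)" using p0 by simp
  show "of_int c = of_int a * (0::rat)\<^sup>2 + of_int b * 0 * (1 / of_int p ^ k) +
    of_int (p ^ (2 * k) * c) * (1 / of_int p ^ k)\<^sup>2" using p0
    by (simp add: field_simps power_mult power2_eq_square power_mult_distrib)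
  show "of_int b = 2 * of_int a * of_int p ^ k * (0::rat) +
      of_int b * (of_int p ^ k * (1 / of_int p ^ k) + 0 * 0) +
      2 * of_int (p ^ (2 * k) * c) * 0 * (1 / of_int p ^ k)" using p0 by simp
  show "(of_int a, of_int b, of_int (p ^ (2 * k) * c)) \<in> bqf_of_disc (Z_inv m) (of_int (1 - 4 * m))"
    using rat_bqf_in_iff[OF m, of "(a, b, p ^ (2 * k) * c)" "1 - 4 * m"] f by simp
qed (use m in \<open>auto simp: power_mult mult.commute power2_eq_square power_mult_distrib intro!: Z_inv_closed Z_inv_closed_numeral\<close>)

text \<open>Hensel lifting works because the polynomial has the simple root \<open>0\<close> modulo \<open>m\<close>.\<close>

lemma root_mod_power:
  fixes m :: int
  shows "\<exists>\<rho>. m dvd \<rho> \<and> m ^ k dvd \<rho>\<^sup>2 + \<rho> + m"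
proof (induction k)
  case 0
  show ?case by (intro exI[of _ 0]) simp
next
  case (Suc k)
  show ?case
  proof (cases "k = 0")
    case True
    then show ?thesis by (intro exI[of _ 0]) simp
  next
    case False
    from Suc obtain \<rho> t where \<rho>: "m dvd \<rho>" "\<rho>\<^sup>2 + \<rho> + m = m ^ k * t" by (metis dvdE)
    then obtain w where w: "\<rho> = m * w" by blast
    obtain j where j: "k = Suc j" using False by (cases k) auto
    \<comment> \<open>A Newton step: the derivative \<open>2 * \<rho> + 1\<close> is 1 modulo m, so
      the error \<open>m ^ k * t\<close> itself is the correction. The quadratic remainder is
      divisible by \<open>m ^ Suc k\<close> because k is positive.\<close>
    have "(\<rho> - m ^ k * t)\<^sup>2 + (\<rho> - m ^ k * t) + m =
        (\<rho>\<^sup>2 + \<rho> + m) - m ^ k * t * (2 * \<rho> + 1) + (m ^ k * t)\<^sup>2"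
      by (simp add: power2_eq_square algebra_simps)
    also have "\<dots> = m ^ Suc k * (m ^ j * t\<^sup>2 - 2 * t * w)"
      unfolding \<rho>(2) by (simp add: w j power2_eq_square algebra_simps)
    finally have "m ^ Suc k dvd (\<rho> - m ^ k * t)\<^sup>2 + (\<rho> - m ^ k * t) + m" by simp
    moreover have "m dvd \<rho> - m ^ k * t" using \<rho>(1) j by simp
    ultimately show ?thesis by blast
  qed
qed

text \<open>Removing \<open>gcd a m\<close> repeatedly terminates, since each removal shrinks
  \<open>\<bar>a\<bar>\<close>. The factor u divides a power of m and is thus a unit of
  \<open>Z_inv m\<close>.\<close>

lemma coprime_part:
  fixes a m :: int
  assumes "a \<noteq> 0" "m \<noteq> 0"
  shows "\<exists>a0 u k. a = a0 * u \<and> coprime a0 m \<and> u dvd m ^ k"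
  using assms(1)
proof (induction "nat \<bar>a\<bar>" arbitrary: a rule: less_induct)
  case less
  show ?case
  proof (cases "coprime a m")
    case True
    then show ?thesis by (intro exI[of _ a] exI[of _ 1]) auto
  next
    case False
    define d where "d = gcd a m"
    have d: "d dvd a" "d dvd m" "d > 1" using False assms less.prems
      by (auto simp: d_def coprime_iff_gcd_eq_1 less_le)
        (smt (verit) gcd_pos_int)
    then obtain a' where a': "a = d * a'" by blast
    have "nat \<bar>a'\<bar> < nat \<bar>a\<bar>" "a' \<noteq> 0" using a' d(3) less.prems by (auto simp: abs_mult)
    from less.hyps[OF this] obtain a0 u k
      where "a' = a0 * u" "coprime a0 m" "u dvd m ^ k" by blast
    then have "a = a0 * (d * u)" "coprime a0 m" "d * u dvd m ^ Suc k"
      using a' d(2) by (auto simp: mult_dvd_mono)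
    then show ?thesis by blast
  qed
qed

section \<open>Integral representatives\<close>

text \<open>For even m the number 2 is invertible. For odd m, clearing denominators in the
  discriminant equation shows that the numerator of b is odd, as is \<open>m ^ k\<close>, so their
  difference is even.\<close>

lemma Z_inv_half_minus_one:
  assumes m: "m \<noteq> 0" and f: "(a, b, c) \<in> bqf_of_disc (Z_inv m) (of_int (1 - 4 * m))"
  obtains \<beta> where "\<beta> \<in> Z_inv m" "b = 2 * \<beta> + 1" "a * c = \<beta>\<^sup>2 + \<beta> + of_int m"
proof -
  have f': "a \<in> Z_inv m" "b \<in> Z_inv m" "c \<in> Z_inv m" "b\<^sup>2 - 4 * a * c = of_int (1 - 4 * m)"
    using f by (auto simp: bqf_of_disc_def bqf_over_def bqf_disc_def)
  have "(b - 1) / 2 \<in> Z_inv m"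
  proof (cases "even m")
    case True
    then have "of_int 1 / of_int 2 \<in> Z_inv m"
      using Z_inv_divide_dvd_power[OF m, of 2 1 1] by simp
    then have "1 / 2 \<in> Z_inv m" by simp
    then have "(b - 1) * (1 / 2) \<in> Z_inv m"
      by (intro Z_inv_ring(4) Z_inv_minus m f'(2) Z_inv_closed_numeral(2))
    then show ?thesis by simp
  next
    case False
    have "a * c \<in> Z_inv m" using f' m by (intro Z_inv_closed)
    then obtain e l where e: "a * c = of_int e / of_int m ^ l" unfolding Z_inv_def by auto
    from f' obtain y k where y: "b = of_int y / of_int m ^ k" unfolding Z_inv_def by auto
    have "of_int (y\<^sup>2 * m ^ l) = (of_int (4 * e * m ^ (2 * k) + (1 - 4 * m) * m ^ (2 * k) * m ^ l) :: rat)"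
    proof -
      have ye: "of_int y = b * of_int m ^ k" "of_int e = a * c * of_int m ^ l"
        using m by (simp_all add: y e)
      have "b\<^sup>2 = 4 * (a * c) + of_int (1 - 4 * m)" using f'(4) by simp
      then have "b\<^sup>2 * (of_int m ^ (2 * k) * of_int m ^ l)
          = (4 * (a * c) + of_int (1 - 4 * m)) * (of_int m ^ (2 * k) * of_int m ^ l)" by simp
      then show ?thesis
        by (simp add: ye power_mult power2_eq_square algebra_simps)
    qed
    then have "y\<^sup>2 * m ^ l = 4 * e * m ^ (2 * k) + (1 - 4 * m) * m ^ (2 * k) * m ^ l"
      by (simp only: of_int_eq_iff)
    moreover have "odd (4 * e * m ^ (2 * k) + (1 - 4 * m) * m ^ (2 * k) * m ^ l)"
      using False by simp
    ultimately have "odd (y\<^sup>2 * m ^ l)" by argo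
    then have "odd y" by simp
    then have "even (y - m ^ k)" using False by simp
    then obtain z where "y - m ^ k = 2 * z" by blast
    then have "of_int y = (2 * of_int z + of_int m ^ k :: rat)"
      by (metis diff_eq_eq of_int_add of_int_mult of_int_numeral of_int_power)
    then have "(b - 1) / 2 = of_int z / of_int m ^ k" using m
      by (simp add: y field_simps)
    then show ?thesis using Z_inv_of_int_div by metis
  qed
  then show thesis
    by (rule that) (use f'(4) in \<open>auto simp: field_simps power2_eq_square\<close>)
qed

text \<open>The discriminant is odd, hence nonzero, so one of a, c, \<open>a + b + c\<close> does
  not vanish and can be moved to the front. Scaling by diag(\<open>m^k\<close>,
  \<open>m^(-k)\<close>) then clears the denominator of the leading coefficient alone.\<close>

lemma SL2_equiv_lead_nonzero:
  assumes m: "m \<noteq> 0" and f: "f \<in> bqf_of_disc (Z_inv m) (of_int (1 - 4 * m))"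
  obtains a b c where "(f, (of_int a, b, c)) \<in> SL2_equiv (Z_inv m) (of_int (1 - 4 * m))" "a \<noteq> 0"
proof -
  let ?B = "Z_inv m" and ?E = "SL2_equiv (Z_inv m) (of_int (1 - 4 * m))"
  have tr: "\<And>f g h. (f, g) \<in> ?E \<Longrightarrow> (g, h) \<in> ?E \<Longrightarrow> (f, h) \<in> ?E"
    using equiv_Z_inv[OF m] unfolding equiv_def by (blast dest: transD)
  note B = Z_inv_closed_numeral[OF m] Z_inv_ring(5)[OF m]
  obtain a b c where abc: "f = (a, b, c)" by (cases f)
  have ex: "\<exists>a' b' c'. ((a, b, c), (a', b', c')) \<in> ?E \<and> a' \<noteq> 0"
  proof -
    have D: "b\<^sup>2 - 4 * a * c = of_int (1 - 4 * m)"
      using f by (auto simp: abc bqf_of_disc_def bqf_disc_def)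
    have "of_int (1 - 4 * m) \<noteq> (0::rat)"
      unfolding of_int_eq_0_iff by presburger
    then consider "a \<noteq> 0" | "c \<noteq> 0" | "a = 0" "c = 0" "b \<noteq> 0" using D by fastforce
    then show ?thesis
    proof cases
      case 1
      have "((a, b, c), (a, b, c)) \<in> ?E"
        by (rule SL2_equivI[where p = 1 and q = 0 and r = 0 and s = 1]) (use m f abc B in auto)
      with 1 show ?thesis by blast
    next
      case 2
      have "((a, b, c), (c, -b, a)) \<in> ?E"
        by (rule SL2_equivI[where p = 0 and q = "-1" and r = 1 and s = 0]) (use m f abc B in auto)
      with 2 show ?thesis by blast
    next
      case 3
      have "((a, b, c), (a + b + c, b + 2 * c, c)) \<in> ?E"
        by (rule SL2_equivI[where p = 1 and q = 0 and r = 1 and s = 1]) (use m f abc B in auto)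
      with 3 show ?thesis by force
    qed
  qed
  then obtain a' b' c' where g: "(f, (a', b', c')) \<in> ?E" "a' \<noteq> 0" by (auto simp: abc)
  then have g': "(a', b', c') \<in> bqf_of_disc ?B (of_int (1 - 4 * m))" by (auto simp: SL2_equiv_def)
  then have "a' \<in> ?B" by (auto simp: bqf_of_disc_def bqf_over_def)
  then obtain A k where A: "a' = of_int A / of_int m ^ k" unfolding Z_inv_def by auto
  have "of_int 1 / of_int m ^ k \<in> ?B" by (rule Z_inv_of_int_div)
  then have "((a', b', c'), (of_int (A * m ^ k), b', c' / of_int m ^ (2 * k))) \<in> ?E"
    by (intro SL2_equivI[where p = "of_int m ^ k" and q = 0 and r = 0 and s = "1 / of_int m ^ k"])
      (use m g' B Z_inv_ring(1)[OF m] in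
        \<open>auto simp: A field_simps power2_eq_square power_mult power_mult_distrib intro: Z_inv_closed\<close>)
  moreover have "A * m ^ k \<noteq> 0" using g(2) m A by auto
  ultimately show thesis using that tr g(1) by blast
qed

text \<open>Write the leading coefficient as \<open>a = a0 u\<close> with \<open>a0\<close> prime to \<open>m\<close> and \<open>u\<close> a unit of \<open>\<int>[1/m]\<close>. The form
  determines its middle coefficient \<open>2 x + 1\<close> only modulo \<open>a0\<close>, and modulo \<open>u\<close> it may be chosen such
  that \<open>x\<^sup>2 + x + m\<close> vanishes.\<close>

lemma SL2_equiv_integral:
  assumes m: "m \<noteq> 0" and f: "f \<in> bqf_of_disc (Z_inv m) (of_int (1 - 4 * m))"
  shows "\<exists>g. (f, rat_bqf g) \<in> SL2_equiv (Z_inv m) (of_int (1 - 4 * m))"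
proof -
  let ?B = "Z_inv m" and ?E = "SL2_equiv (Z_inv m) (of_int (1 - 4 * m))"
  have tr: "\<And>f g h. (f, g) \<in> ?E \<Longrightarrow> (g, h) \<in> ?E \<Longrightarrow> (f, h) \<in> ?E"
    using equiv_Z_inv[OF m] unfolding equiv_def by (blast dest: transD)
  obtain a b c where g: "(f, (of_int a, b, c)) \<in> ?E" and a: "a \<noteq> 0"
    using SL2_equiv_lead_nonzero[OF m f] .
  then have g': "(of_int a, b, c) \<in> bqf_of_disc ?B (of_int (1 - 4 * m))" by (auto simp: SL2_equiv_def)
  then have "c \<in> ?B" by (auto simp: bqf_of_disc_def bqf_over_def)
  obtain \<beta> where \<beta>: "\<beta> \<in> ?B" "b = 2 * \<beta> + 1" "of_int a * c = \<beta>\<^sup>2 + \<beta> + of_int m"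
    using Z_inv_half_minus_one[OF m g'] .
  from \<open>c \<in> ?B\<close> obtain e l where e: "c = of_int e / of_int m ^ l" unfolding Z_inv_def by auto
  from \<beta>(1) obtain y k where y: "\<beta> = of_int y / of_int m ^ k" unfolding Z_inv_def by auto
  obtain a0 u j where u: "a = a0 * u" "coprime a0 m" "u dvd m ^ j"
    using coprime_part[OF a m] by blast
  obtain \<rho> where \<rho>: "m ^ j dvd \<rho>\<^sup>2 + \<rho> + m" using root_mod_power by blast
  have "coprime a0 (m ^ k)" using u(2) by simp
  then obtain v where v: "[m ^ k * v = 1] (mod a0)"
    using cong_solve_coprime_int[of "m ^ k" a0] by (auto simp: coprime_commute)
  have "coprime a0 u" using u(2,3)
    by (metis coprime_divisors coprime_power_right_iff dvd_refl)
  \<comment> \<open>As v inverts the denominator \<open>m ^ k\<close> modulo \<open>a0\<close>, the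
    residue \<open>y * v\<close> is that of \<open>\<beta>\<close>. Modulo u, where the form imposes
    nothing, x is the lifted root.\<close>
  then obtain x where x: "[x = y * v] (mod a0)" "[x = \<rho>] (mod u)"
    using binary_chinese_remainder_int by blast
  have "[m ^ k * x = y] (mod a0)"
  proof -
    have "[m ^ k * x = m ^ k * (y * v)] (mod a0)" using x(1) by (rule cong_scalar_left)
    also have "m ^ k * (y * v) = y * (m ^ k * v)" by (simp add: ac_simps)
    also have "[y * (m ^ k * v) = y * 1] (mod a0)" using v by (rule cong_scalar_left)
    finally show ?thesis by simp
  qed
  then obtain t where t: "m ^ k * x - y = a0 * t" unfolding cong_iff_dvd_diff by blast
  \<comment> \<open>The translation carrying \<open>\<beta>\<close> to x. It lies in
    \<open>Z_inv m\<close> because \<open>a0\<close> divides the numerator of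
    \<open>x - \<beta>\<close>, and the rest of a is a unit.\<close>
  define s where "s = (of_int x - \<beta>) / of_int a"
  have sB: "s \<in> ?B"
  proof -
    have nz: "u \<noteq> 0" "a0 \<noteq> 0" using a u(1) by auto
    have "of_int m ^ k * of_int x - of_int y = (of_int a0 * of_int t :: rat)"
      using t by (metis of_int_diff of_int_mult of_int_power)
    then have "s = (of_int t / of_int u) * (of_int 1 / of_int m ^ k)"
      using m nz by (simp add: s_def y u(1) field_simps)
    moreover have "of_int t / of_int u \<in> ?B" using u(3) by (rule Z_inv_divide_dvd_power[OF m])
    ultimately show ?thesis using Z_inv_of_int_div Z_inv_ring(4)[OF m] by metis
  qed
  \<comment> \<open>Up to powers of m, which are prime to \<open>a0\<close>, the value at x agrees
    modulo \<open>a0\<close> with the value at \<open>\<beta>\<close>, and that one is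
    \<open>a * c\<close>.\<close>
  have "a0 dvd m ^ l * (m ^ k)\<^sup>2 * (x\<^sup>2 + x + m)"
  proof -
    have "of_int (m ^ l * (y\<^sup>2 + y * m ^ k + m * (m ^ k)\<^sup>2)) = (of_int (a * e * (m ^ k)\<^sup>2) :: rat)"
    proof -
      have ye: "of_int y = \<beta> * of_int m ^ k" "of_int e = c * of_int m ^ l"
        using m by (simp_all add: y e)
      have "of_int (m ^ l * (y\<^sup>2 + y * m ^ k + m * (m ^ k)\<^sup>2)) =
          (\<beta>\<^sup>2 + \<beta> + of_int m) * (of_int m ^ l * (of_int m ^ k)\<^sup>2)"
        by (simp add: ye power2_eq_square algebra_simps)
      also have "\<dots> = of_int (a * e * (m ^ k)\<^sup>2)"
        unfolding \<beta>(3)[symmetric] by (simp add: ye algebra_simps)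
      finally show ?thesis .
    qed
    then have eq: "m ^ l * (y\<^sup>2 + y * m ^ k + m * (m ^ k)\<^sup>2) = a * e * (m ^ k)\<^sup>2"
      by (simp only: of_int_eq_iff)
    have "m ^ l * (m ^ k)\<^sup>2 * (x\<^sup>2 + x + m) =
        m ^ l * ((m ^ k * x)\<^sup>2 + (m ^ k * x) * m ^ k + m * (m ^ k)\<^sup>2)"
      by (simp add: power2_eq_square algebra_simps)
    moreover have "[m ^ l * ((m ^ k * x)\<^sup>2 + (m ^ k * x) * m ^ k + m * (m ^ k)\<^sup>2)
        = m ^ l * (y\<^sup>2 + y * m ^ k + m * (m ^ k)\<^sup>2)] (mod a0)"
      by (intro cong_mult cong_add cong_pow cong_refl \<open>[m ^ k * x = y] (mod a0)\<close>)
    moreover have "[a * e * (m ^ k)\<^sup>2 = 0] (mod a0)" by (simp add: u(1) cong_0_iff)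
    ultimately show ?thesis by (metis eq cong_0_iff cong_trans)
  qed
  moreover have "coprime a0 (m ^ l * (m ^ k)\<^sup>2)" using u(2) by simp
  ultimately have "a0 dvd x\<^sup>2 + x + m" by (simp add: coprime_dvd_mult_right_iff)
  moreover have "u dvd x\<^sup>2 + x + m"
  proof -
    have "[x\<^sup>2 + x + m = \<rho>\<^sup>2 + \<rho> + m] (mod u)"
      by (intro cong_add cong_pow cong_refl x(2))
    moreover have "u dvd \<rho>\<^sup>2 + \<rho> + m" using \<rho> u(3) by (rule dvd_trans[rotated])
    ultimately show ?thesis using cong_dvd_iff by blast
  qed
  ultimately have "a dvd x\<^sup>2 + x + m" using \<open>coprime a0 u\<close> by (simp add: u(1) divides_mult)
  then obtain w where w: "x\<^sup>2 + x + m = a * w" by blast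
  have "((of_int a, b, c), (of_int a, of_int (2 * x + 1), of_int w)) \<in> ?E"
  proof (rule SL2_equivI[where p = 1 and q = s and r = 0 and s = 1])
    have xs: "of_int x = \<beta> + of_int a * s" using a by (simp add: s_def)
    show "of_int (2 * x + 1) = 2 * of_int a * 1 * s + b * (1 * 1 + s * 0) + 2 * c * 0 * 1"
      by (simp add: xs \<beta>(2))
    have "of_int a * of_int w = (of_int x)\<^sup>2 + of_int x + (of_int m :: rat)"
      using w by (metis of_int_add of_int_mult of_int_power)
    also have "\<dots> = of_int a * (of_int a * s\<^sup>2 + b * s * 1 + c * 1\<^sup>2)"
      using \<beta>(3) unfolding xs \<beta>(2) by (simp add: power2_eq_square algebra_simps)
    finally show "of_int w = of_int a * s\<^sup>2 + b * s * 1 + c * 1\<^sup>2" using a by simp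
  qed (use m g' sB Z_inv_closed_numeral[OF m] in auto)
  then have "((of_int a, b, c), rat_bqf (a, 2 * x + 1, w)) \<in> ?E" by simp
  then show ?thesis using tr g by blast
qed

section \<open>Reduction and similarities\<close>

definition bqf_content :: "int bqf \<Rightarrow> int" where
  "bqf_content = (\<lambda>(a, b, c). gcd a (gcd b c))"

lemma dvd_bqf_content_iff: "g dvd bqf_content (a, b, c) \<longleftrightarrow> g dvd a \<and> g dvd b \<and> g dvd c"
  by (simp add: bqf_content_def)

lemma bqf_content_nonneg: "bqf_content f \<ge> 0"
  by (cases f) (simp add: bqf_content_def)

lemma coprime_dvd_Z_inv:
  assumes m: "m \<noteq> 0" and "coprime g m" and h: "h \<in> Z_inv m" and x: "of_int x = of_int g * h"
  shows "g dvd x"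
proof -
  from h obtain y k where "h = of_int y / of_int m ^ k" unfolding Z_inv_def by auto
  then have "of_int (x * m ^ k) = (of_int (g * y) :: rat)" using m x by (simp add: field_simps)
  then have "x * m ^ k = g * y" by (simp only: of_int_eq_iff)
  then have "g dvd x * m ^ k" by simp
  moreover have "coprime g (m ^ k)" using assms(2) by simp
  ultimately show ?thesis by (simp add: coprime_dvd_mult_left_iff)
qed

text \<open>The square of g divides \<open>1 - 4 * m\<close>, so g is prime to m. Denominators of
  the matrix entries are powers of m and cannot cancel g.\<close>

lemma common_divisor_zequiv:
  assumes m: "m \<noteq> 0" and z: "zequiv m (a, b, c) (a', b', c')"
    and g: "g dvd a" "g dvd b" "g dvd c"
  shows "g dvd a'" "g dvd b'" "g dvd c'"
proof -
  from g obtain a1 b1 c1 where g1: "a = g * a1" "b = g * b1" "c = g * c1" by (auto elim!: dvdE)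
  have "g\<^sup>2 dvd b\<^sup>2 - 4 * a * c" by (auto simp: g1 power2_eq_square intro!: dvd_diff)
  then have "g dvd 1 - 4 * m"
    using zequiv_disc(1)[OF m z] by (simp add: bqf_disc_def power2_eq_square dvd_mult_left)
  have cop: "coprime g m"
  proof (rule coprimeI)
    fix d assume "d dvd g" "d dvd m"
    then have "d dvd (1 - 4 * m) + 4 * m"
      using \<open>g dvd 1 - 4 * m\<close> by (intro dvd_add) (auto intro: dvd_trans)
    then show "is_unit d" by simp
  qed
  from z obtain A where A: "A \<in> SL2 (Z_inv m)"
    "rat_bqf (a', b', c') = bqf_subst A (rat_bqf (a, b, c))"
    unfolding zequiv_def SL2_equiv_def by auto
  define p q r s where pqrs: "p = A $ 1 $ 1" "q = A $ 1 $ 2" "r = A $ 2 $ 1" "s = A $ 2 $ 2"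
  have B: "p \<in> Z_inv m" "q \<in> Z_inv m" "r \<in> Z_inv m" "s \<in> Z_inv m"
    using A(1) by (auto simp: SL2_def pqrs)
  have e: "of_int a' = of_int g * (of_int a1 * p\<^sup>2 + of_int b1 * p * r + of_int c1 * r\<^sup>2)"
    "of_int b' = of_int g * (2 * of_int a1 * p * q + of_int b1 * (p * s + q * r) + 2 * of_int c1 * r * s)"
    "of_int c' = of_int g * (of_int a1 * q\<^sup>2 + of_int b1 * q * s + of_int c1 * s\<^sup>2)"
    using A(2) by (simp_all add: bqf_subst_def Let_def g1 algebra_simps flip: pqrs)
  show "g dvd a'" by (rule coprime_dvd_Z_inv[OF m cop _ e(1)]) (intro Z_inv_closed m B)
  show "g dvd b'" by (rule coprime_dvd_Z_inv[OF m cop _ e(2)]) (intro Z_inv_closed Z_inv_closed_numeral m B)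
  show "g dvd c'" by (rule coprime_dvd_Z_inv[OF m cop _ e(3)]) (intro Z_inv_closed m B)
qed

lemma bqf_content_zequiv:
  assumes m: "m \<noteq> 0" and z: "zequiv m f g"
  shows "bqf_content f = bqf_content g"
proof -
  have "bqf_content f dvd bqf_content g" if "zequiv m f g" for f g
  proof -
    obtain a b c a' b' c' where fg: "f = (a, b, c)" "g = (a', b', c')" by (cases f; cases g)
    have "bqf_content f dvd a" "bqf_content f dvd b" "bqf_content f dvd c"
      using dvd_bqf_content_iff[of "bqf_content f" a b c] by (simp_all add: fg)
    from common_divisor_zequiv[OF m that[unfolded fg] this] show ?thesis
      by (simp add: fg(2) dvd_bqf_content_iff)
  qed
  then have "bqf_content f dvd bqf_content g" "bqf_content g dvd bqf_content f"
    using z zequiv_sym[OF m z] by blast+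
  then show ?thesis using zdvd_antisym_nonneg bqf_content_nonneg by blast
qed

section \<open>Reduction by minimizing the leading coefficient\<close>

lemma bounded_translate:
  fixes a b :: int
  assumes "a \<noteq> 0"
  obtains s where "\<bar>b + 2 * a * s\<bar> \<le> \<bar>a\<bar>"
proof -
  define r where "r = (b + \<bar>a\<bar>) mod (2 * \<bar>a\<bar>)"
  define t where "t = (b + \<bar>a\<bar>) div (2 * \<bar>a\<bar>)"
  have "0 \<le> r" "r < 2 * \<bar>a\<bar>" using assms by (simp_all add: r_def)
  moreover have "b + \<bar>a\<bar> = 2 * \<bar>a\<bar> * t + r" by (simp add: r_def t_def)
  moreover have "2 * \<bar>a\<bar> * t = 2 * a * (sgn a * t)" by (simp add: abs_sgn mult.assoc)
  ultimately have "\<bar>b + 2 * a * (- (sgn a * t))\<bar> \<le> \<bar>a\<bar>" by simp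
  then show thesis by (rule that)
qed

text \<open>Stated for an abstract Q because it is used for two orbits: the class over
  \<open>Z_inv m\<close>, which yields representatives, and the orbit of the integral matrices.
  Minimality applied to the swapped form gives \<open>\<bar>a\<bar> \<le> \<bar>c\<bar>\<close>; if
  \<open>a = 0\<close>, translations change c by multiples of b.\<close>

lemma minimal_form:
  fixes Q :: "int bqf \<Rightarrow> bool"
  assumes Q: "Q f"
    and tr: "\<And>a b c s. Q (a, b, c) \<Longrightarrow> Q (a, b + 2 * a * s, a * s\<^sup>2 + b * s + c)"
    and sw: "\<And>a b c. Q (a, b, c) \<Longrightarrow> Q (c, - b, a)"
    and nz: "\<And>b c. Q (0, b, c) \<Longrightarrow> b \<noteq> 0"
  shows "\<exists>a b c. Q (a, b, c) \<and> (\<forall>a' b' c'. Q (a', b', c') \<longrightarrow> \<bar>a\<bar> \<le> \<bar>a'\<bar>) \<and>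
    (a = 0 \<and> 0 \<le> c \<and> c < \<bar>b\<bar> \<or> a \<noteq> 0 \<and> \<bar>b\<bar> \<le> \<bar>a\<bar> \<and> \<bar>a\<bar> \<le> \<bar>c\<bar>)"
proof -
  obtain g where g: "Q g" "\<And>h. Q h \<Longrightarrow> nat \<bar>fst g\<bar> \<le> nat \<bar>fst h\<bar>"
    using ex_has_least_nat[of Q f "\<lambda>f. nat \<bar>fst f\<bar>"] Q by blast
  obtain a b c where abc: "g = (a, b, c)" by (cases g)
  have min: "\<bar>a\<bar> \<le> \<bar>a'\<bar>" if "Q (a', b', c')" for a' b' c' using g(2)[OF that] by (simp add: abc)
  show ?thesis
  proof (cases "a = 0")
    case True
    have b: "b \<noteq> 0" using nz g(1) by (auto simp: abc True)
    have "c mod \<bar>b\<bar> = c - \<bar>b\<bar> * (c div \<bar>b\<bar>)" by (simp add: minus_mult_div_eq_mod)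
    also have "\<dots> = a * (- (sgn b * (c div \<bar>b\<bar>)))\<^sup>2 + b * (- (sgn b * (c div \<bar>b\<bar>))) + c"
      by (simp add: True abs_sgn mult.assoc)
    finally have "Q (a, b + 2 * a * (- (sgn b * (c div \<bar>b\<bar>))), c mod \<bar>b\<bar>)"
      using tr[OF g(1)[unfolded abc]] by metis
    then have "Q (a, b, c mod \<bar>b\<bar>)" by (simp add: True)
    moreover have "0 \<le> c mod \<bar>b\<bar>" "c mod \<bar>b\<bar> < \<bar>b\<bar>" using b by simp_all
    ultimately show ?thesis using True min by blast
  next
    case False
    from bounded_translate[OF False] obtain s where s: "\<bar>b + 2 * a * s\<bar> \<le> \<bar>a\<bar>" .
    from tr[OF g(1)[unfolded abc], of s]
    have Q': "Q (a, b + 2 * a * s, a * s\<^sup>2 + b * s + c)" .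
    with min[OF sw[OF this]] min s False show ?thesis by blast
  qed
qed

lemma zequiv_translate:
  assumes m: "m \<noteq> 0" and z: "zequiv m f (a, b, c)"
  shows "zequiv m f (a, b + 2 * a * s, a * s\<^sup>2 + b * s + c)"
proof -
  have "zequiv m (a, b, c) (a, b + 2 * a * s, a * s\<^sup>2 + b * s + c)"
    by (rule zequiv_int[where p = 1 and q = s and r = 0 and s = 1])
      (use m zequiv_disc(2)[OF m z] in \<open>auto simp: algebra_simps\<close>)
  then show ?thesis using zequiv_trans[OF m z] by blast
qed

lemma zequiv_swap:
  assumes m: "m \<noteq> 0" and z: "zequiv m f (a, b, c)"
  shows "zequiv m f (c, - b, a)"
proof -
  have "zequiv m (a, b, c) (c, - b, a)"
    by (rule zequiv_int[where p = 0 and q = "-1" and r = 1 and s = 0])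
      (use m zequiv_disc(2)[OF m z] in \<open>auto simp: algebra_simps\<close>)
  then show ?thesis using zequiv_trans[OF m z] by blast
qed

lemma disc_odd:
  fixes a b c m :: int
  assumes "bqf_disc (a, b, c) = 1 - 4 * m"
  shows "odd b"
proof
  assume "even b"
  then obtain t where "b = 2 * t" by blast
  then have "4 * (t\<^sup>2 - a * c + m) = 1" using assms by (simp add: bqf_disc_def)
  then show False by presburger
qed

lemma zequiv_minimal_form:
  assumes m: "m \<noteq> 0" and f: "bqf_disc f = 1 - 4 * m"
  shows "\<exists>a b c. zequiv m f (a, b, c) \<and> (\<forall>a' b' c'. zequiv m f (a', b', c') \<longrightarrow> \<bar>a\<bar> \<le> \<bar>a'\<bar>) \<and>
    (a = 0 \<and> 0 \<le> c \<and> c < \<bar>b\<bar> \<or> a \<noteq> 0 \<and> \<bar>b\<bar> \<le> \<bar>a\<bar> \<and> \<bar>a\<bar> \<le> \<bar>c\<bar>)"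
proof (rule minimal_form)
  show "zequiv m f f" using zequiv_refl[OF m f] .
  show "b \<noteq> 0" if "zequiv m f (0, b, c)" for b c
    using disc_odd[OF zequiv_disc(2)[OF m that]] by auto
qed (use zequiv_translate zequiv_swap m in blast)+

text \<open>Reducedness gives \<open>b\<^sup>2 \<le> \<bar>a * c\<bar>\<close>, so
  \<open>4 * a * c\<close> dominates the discriminant whatever its sign.\<close>

lemma reduced_bounds:
  fixes a b c :: int
  assumes "\<bar>b\<bar> \<le> \<bar>a\<bar>" "\<bar>a\<bar> \<le> \<bar>c\<bar>"
  shows "3 * (\<bar>a\<bar> * \<bar>c\<bar>) \<le> \<bar>bqf_disc (a, b, c)\<bar>" "3 * a\<^sup>2 \<le> \<bar>bqf_disc (a, b, c)\<bar>"
proof -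
  have b2: "b\<^sup>2 \<le> \<bar>a\<bar> * \<bar>c\<bar>"
    using mult_mono[of "\<bar>b\<bar>" "\<bar>a\<bar>" "\<bar>b\<bar>" "\<bar>c\<bar>"] assms
    by (simp add: power2_eq_square flip: abs_mult)
  have a2: "a\<^sup>2 \<le> \<bar>a\<bar> * \<bar>c\<bar>"
    using mult_left_mono[OF assms(2), of "\<bar>a\<bar>"] by (simp add: power2_eq_square flip: abs_mult)
  have "3 * \<bar>t\<bar> \<le> \<bar>u - 4 * t\<bar>" if "0 \<le> u" "u \<le> \<bar>t\<bar>" for t u :: int
    using that by linarith
  from this[of "b\<^sup>2" "a * c"] b2 show *: "3 * (\<bar>a\<bar> * \<bar>c\<bar>) \<le> \<bar>bqf_disc (a, b, c)\<bar>"
    by (simp add: bqf_disc_def mult.assoc flip: abs_mult)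
  then show "3 * a\<^sup>2 \<le> \<bar>bqf_disc (a, b, c)\<bar>" using a2 by linarith
qed

section \<open>Integral substitutions of arbitrary determinant, and similarities of a form\<close>

definition sub4 :: "int \<Rightarrow> int \<Rightarrow> int \<Rightarrow> int \<Rightarrow> int bqf \<Rightarrow> int bqf" where
  "sub4 p q r s = (\<lambda>(a, b, c). (a * p\<^sup>2 + b * p * r + c * r\<^sup>2,
     2 * a * p * q + b * (p * s + q * r) + 2 * c * r * s, a * q\<^sup>2 + b * q * s + c * s\<^sup>2))"

lemma sub4_sub4:
  "sub4 p' q' r' s' (sub4 p q r s f) =
    sub4 (p * p' + q * r') (p * q' + q * s') (r * p' + s * r') (r * q' + s * s') f"
  by (cases f) (simp add: sub4_def power2_eq_square algebra_simps)

lemma sub4_id: "sub4 1 0 0 1 f = f"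
  by (cases f) (simp add: sub4_def)

lemma sub4_inverse:
  assumes "p * s - q * r = 1"
  shows "sub4 s (- q) (- r) p (sub4 p q r s f) = f"
proof -
  have "p * s + q * (- r) = 1" "p * - q + q * p = 0" "r * s + s * - r = 0" "r * - q + s * p = 1"
    using assms by (simp_all add: algebra_simps)
  then show ?thesis by (simp only: sub4_sub4 sub4_id)
qed

lemma zequiv_sub4:
  assumes m: "m \<noteq> 0" and f: "bqf_disc f = 1 - 4 * m" and det: "p * s - q * r = 1"
  shows "zequiv m f (sub4 p q r s f)"
proof -
  obtain a b c where abc: "f = (a, b, c)" by (cases f)
  show ?thesis unfolding abc sub4_def prod.case
    by (rule zequiv_int[OF m f[unfolded abc] det]) auto
qed

text \<open>A similarity commutes with the form up to the adjugate, so its matrix is a linear combination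
  of the identity and the matrix attached to the form.\<close>

lemma similarity:
  assumes "sub4 p q r s (a, b, c) = (n * a, n * b, n * c)" and n: "n = p * s - q * r" "n \<noteq> 0"
  shows "r * b = a * (s - p)" "r * c = - (a * q)"
proof -
  \<comment> \<open>The equations for the first two coefficients say that (X, Y) is annihilated by
    the transposed matrix, whose determinant is the nonzero n.\<close>
  define X where "X = a * (p - s) + r * b"
  define Y where "Y = a * q + c * r"
  have eqs: "n * a = a * p\<^sup>2 + b * p * r + c * r\<^sup>2"
    "n * b = 2 * a * p * q + b * (p * s + q * r) + 2 * c * r * s"
    using assms(1) by (simp_all add: sub4_def)
  have 1: "p * X + r * Y = 0"
    using eqs(1) by (simp add: X_def Y_def n power2_eq_square algebra_simps)
  have "2 * (q * X + s * Y) = 0"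
    using eqs(2) by (simp add: X_def Y_def n algebra_simps)
  then have 2: "q * X + s * Y = 0" by simp
  have "n * X = s * (p * X + r * Y) - r * (q * X + s * Y)" by (simp add: n algebra_simps)
  then have "X = 0" using n(2) by (simp add: 1 2)
  have "n * Y = p * (q * X + s * Y) - q * (p * X + r * Y)" by (simp add: n algebra_simps)
  then have "Y = 0" using n(2) by (simp add: 1 2)
  show "r * b = a * (s - p)" "r * c = - (a * q)"
    using \<open>X = 0\<close> \<open>Y = 0\<close> by (simp_all add: X_def Y_def algebra_simps)
qed

text \<open>By \<open>similarity\<close>, both \<open>r * b\<close> and \<open>r * c\<close> are
  multiples of a, and so is \<open>r * a\<close>. Hence a divides r times the content.\<close>

lemma similarity_lead_le:
  assumes "sub4 p q r s (a, b, c) = (n * a, n * b, n * c)" and n: "n = p * s - q * r" "n \<noteq> 0"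
    and r: "r \<noteq> 0"
  shows "\<bar>a\<bar> \<le> \<bar>r\<bar> * bqf_content (a, b, c)"
proof (cases "a = 0")
  case True
  then show ?thesis by (simp add: bqf_content_nonneg)
next
  case False
  note sim = similarity[OF assms(1-3)]
  have "a dvd gcd (r * a) (gcd (r * b) (r * c))"
    by (simp add: sim)
  also have "gcd (r * a) (gcd (r * b) (r * c)) = gcd (r * a) (\<bar>r\<bar> * gcd b c)"
    by (simp only: gcd_mult_distrib_int)
  also have "\<dots> = gcd (r * a) (r * gcd b c)"
    by (metis abs_abs abs_mult gcd_abs2_int)
  also have "\<dots> = \<bar>r\<bar> * bqf_content (a, b, c)"
    by (simp add: bqf_content_def gcd_mult_distrib_int)
  finally have "a dvd \<bar>r\<bar> * bqf_content (a, b, c)" .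
  moreover have "\<bar>r\<bar> * bqf_content (a, b, c) > 0"
    using False r by (simp add: bqf_content_def)
  ultimately show ?thesis using zdvd_imp_le by force
qed

text \<open>With the trace \<open>t = p + s\<close>, the relations of \<open>similarity\<close> give
  \<open>D * r^2 = a^2 * (t^2 - 4 * n)\<close>, D being the discriminant. Dropping
  \<open>t^2\<close> and bounding a by r times the content, the factor \<open>r^2\<close>
  cancels.\<close>

lemma similarity_disc_le:
  assumes "sub4 p q r s (a, b, c) = (n * a, n * b, n * c)" and n: "n = p * s - q * r" "n > 0"
    and r: "r \<noteq> 0"
  shows "- bqf_disc (a, b, c) \<le> 4 * n * (bqf_content (a, b, c))\<^sup>2"
proof -
  define g where "g = bqf_content (a, b, c)"
  have n0: "n \<noteq> 0" using n by simp
  note sim = similarity[OF assms(1) n(1) n0]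
  have "bqf_disc (a, b, c) * r\<^sup>2 = (r * b)\<^sup>2 - 4 * a * r * (r * c)"
    by (simp add: bqf_disc_def power2_eq_square algebra_simps)
  also have "\<dots> = a\<^sup>2 * ((p + s)\<^sup>2 - 4 * n)"
    unfolding sim by (simp add: n power2_eq_square algebra_simps)
  finally have "- bqf_disc (a, b, c) * r\<^sup>2 = 4 * n * a\<^sup>2 - a\<^sup>2 * (p + s)\<^sup>2"
    by (simp add: algebra_simps)
  also have "\<dots> \<le> 4 * n * a\<^sup>2" by simp
  also have "\<dots> \<le> 4 * n * (\<bar>r\<bar> * g)\<^sup>2"
  proof (rule mult_left_mono)
    show "a\<^sup>2 \<le> (\<bar>r\<bar> * g)\<^sup>2"
      using power_mono[OF similarity_lead_le[OF assms(1) n(1) n0 r] abs_ge_zero, of 2]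
      by (simp add: g_def)
  qed (use n in simp)
  also have "\<dots> = (4 * n * g\<^sup>2) * r\<^sup>2" by (simp add: power_mult_distrib algebra_simps)
  finally have "- bqf_disc (a, b, c) * r\<^sup>2 \<le> (4 * n * g\<^sup>2) * r\<^sup>2" .
  moreover have "r\<^sup>2 > 0" using r by simp
  ultimately show ?thesis unfolding g_def by (rule mult_right_le_imp_le)
qed

section \<open>Many integral forms in one class\<close>

text \<open>A pure size condition for forms of either sign of discriminant; no boundary convention
  is imposed, since only bounds are drawn from it.\<close>

definition is_reduced :: "int bqf \<Rightarrow> bool" where
  "is_reduced = (\<lambda>(a, b, c). a \<noteq> 0 \<and> \<bar>b\<bar> \<le> \<bar>a\<bar> \<and> \<bar>a\<bar> \<le> \<bar>c\<bar>)"

text \<open>The integral matrix is part of the conclusion because two reductions that coincide will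
  be compared by composing their matrices.\<close>

lemma definite_reduction:
  assumes m: "m > 0" and f: "bqf_disc f = 1 - 4 * m"
  obtains p q r s where "p * s - q * r = 1" "is_reduced (sub4 p q r s f)" "zequiv m f (sub4 p q r s f)"
proof -
  define Q where "Q g \<longleftrightarrow> (\<exists>p q r s. p * s - q * r = 1 \<and> g = sub4 p q r s f)" for g
  have Qsub: "Q (sub4 p' q' r' s' g)" if "Q g" and d': "p' * s' - q' * r' = 1" for g p' q' r' s'
  proof -
    from that obtain p q r s where d: "p * s - q * r = 1" and g: "g = sub4 p q r s f"
      unfolding Q_def by blast
    have "(p * p' + q * r') * (r * q' + s * s') - (p * q' + q * s') * (r * p' + s * r')
        = (p * s - q * r) * (p' * s' - q' * r')" by (simp add: algebra_simps)
    then show ?thesis unfolding Q_def g sub4_sub4 using d d' by fastforce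
  qed
  have Qz: "zequiv m f g" if "Q g" for g
    using that zequiv_sub4[of m f] m f unfolding Q_def by auto
  have "\<exists>a b c. Q (a, b, c) \<and> (\<forall>a' b' c'. Q (a', b', c') \<longrightarrow> \<bar>a\<bar> \<le> \<bar>a'\<bar>) \<and>
    (a = 0 \<and> 0 \<le> c \<and> c < \<bar>b\<bar> \<or> a \<noteq> 0 \<and> \<bar>b\<bar> \<le> \<bar>a\<bar> \<and> \<bar>a\<bar> \<le> \<bar>c\<bar>)"
  proof (rule minimal_form)
    show "Q f" unfolding Q_def by (intro exI[of _ 1] exI[of _ 0]) (simp add: sub4_id)
    show "Q (a, b + 2 * a * s, a * s\<^sup>2 + b * s + c)" if "Q (a, b, c)" for a b c s
      using Qsub[OF that, of 1 1 s 0] by (simp add: sub4_def algebra_simps)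
    show "Q (c, - b, a)" if "Q (a, b, c)" for a b c
      using Qsub[OF that, of 0 0 "-1" 1] by (simp add: sub4_def)
    show "b \<noteq> 0" if "Q (0, b, c)" for b c
      using disc_odd[OF zequiv_disc(2)[OF _ Qz[OF that]]] m by auto
  qed
  then obtain a b c where g: "Q (a, b, c)"
    "a = 0 \<and> 0 \<le> c \<and> c < \<bar>b\<bar> \<or> a \<noteq> 0 \<and> \<bar>b\<bar> \<le> \<bar>a\<bar> \<and> \<bar>a\<bar> \<le> \<bar>c\<bar>" by blast
  have "b\<^sup>2 - 4 * a * c = 1 - 4 * m"
    using zequiv_disc(2)[OF _ Qz[OF g(1)]] m by (simp add: bqf_disc_def)
  moreover have "b\<^sup>2 \<ge> 0" by simp
  ultimately have "a \<noteq> 0" using m by (intro notI) simp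
  with g have "is_reduced (a, b, c)" by (simp add: is_reduced_def)
  with g(1) Qz that show thesis unfolding Q_def by metis
qed

text \<open>The values a, c and \<open>a - b + c\<close> occur as leading coefficients. If p divided
  all three it would divide b, hence the discriminant, which is 1 modulo p.\<close>

lemma lead_not_dvd:
  assumes m: "m \<noteq> 0" and f: "bqf_disc f = 1 - 4 * m" and p: "prime p" "p dvd m"
  obtains a b c where "zequiv m f (a, b, c)" "\<not> p dvd a"
proof -
  obtain a b c where abc: "f = (a, b, c)" by (cases f)
  have z: "zequiv m f (a, b, c)" using zequiv_refl[OF m f] by (simp add: abc)
  have z1: "zequiv m f (c, - b, a)" by (rule zequiv_swap[OF m z])
  have z2: "zequiv m f (c - b + a, - (- b + 2 * c), c)"
    using zequiv_swap[OF m zequiv_translate[OF m z1, of 1]] zequiv_swap[OF m] m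
    by (auto simp: algebra_simps dest: zequiv_swap[OF m])
  have "\<not> (p dvd a \<and> p dvd c \<and> p dvd c - b + a)"
  proof
    assume *: "p dvd a \<and> p dvd c \<and> p dvd c - b + a"
    have "b = c + a - (c - b + a)" by simp
    then have "p dvd b" using * by (metis dvd_add dvd_diff)
    have "1 = b\<^sup>2 - 4 * a * c + 4 * m" using f by (simp add: abc bqf_disc_def)
    then have "p dvd 1" using * \<open>p dvd b\<close> p(2)
      by (metis dvd_add dvd_diff dvd_mult dvd_mult2 power2_eq_square)
    then show False using p(1) by (simp add: not_prime_unit)
  qed
  with z z1 z2 that show thesis by blast
qed

text \<open>With a prime to p, a translation can move the middle coefficient to a root of
  \<open>x^2 + x + m\<close> modulo \<open>p ^ N\<close>. Then \<open>p ^ N\<close> divides the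
  product of the outer coefficients, hence the last one.\<close>

lemma lift_root:
  assumes m: "m \<noteq> 0" and f: "bqf_disc f = 1 - 4 * m" and p: "prime p" "p dvd m"
  obtains a b c where "zequiv m f (a, b, p ^ N * c)"
proof -
  from lead_not_dvd[OF assms] obtain a b c where z: "zequiv m f (a, b, c)" and a: "\<not> p dvd a" .
  have D: "b\<^sup>2 - 4 * a * c = 1 - 4 * m" using zequiv_disc(2)[OF m z] by (simp add: bqf_disc_def)
  have "odd b" by (rule disc_odd[OF zequiv_disc(2)[OF m z]])
  then obtain \<beta> where \<beta>: "b = 2 * \<beta> + 1" by (elim oddE)
  have ac: "a * c = \<beta>\<^sup>2 + \<beta> + m" using D by (simp add: \<beta> power2_eq_square algebra_simps)
  obtain \<rho> where "m ^ N dvd \<rho>\<^sup>2 + \<rho> + m" using root_mod_power by blast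
  then have \<rho>: "p ^ N dvd \<rho>\<^sup>2 + \<rho> + m" using p(2) dvd_power_same dvd_trans by blast
  have cop: "coprime a (p ^ N)"
    using prime_imp_coprime[OF p(1) a] by (simp add: coprime_commute)
  then obtain x where x: "[x = \<beta>] (mod a)" "[x = \<rho>] (mod p ^ N)"
    using binary_chinese_remainder_int by blast
  then obtain s where s: "x = \<beta> + a * s" unfolding cong_iff_dvd_diff by (metis add_diff_cancel_left' diff_add_cancel dvdE add.commute)
  have c': "a * (a * s\<^sup>2 + b * s + c) = x\<^sup>2 + x + m"
    using ac by (simp add: s \<beta> power2_eq_square algebra_simps)
  have "[x\<^sup>2 + x + m = \<rho>\<^sup>2 + \<rho> + m] (mod p ^ N)" by (intro cong_add cong_pow cong_refl x(2))
  then have "p ^ N dvd a * (a * s\<^sup>2 + b * s + c)" using \<rho> cong_dvd_iff c' by metis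
  then have "p ^ N dvd a * s\<^sup>2 + b * s + c"
    using cop by (simp add: coprime_dvd_mult_right_iff coprime_commute)
  then obtain w where "a * s\<^sup>2 + b * s + c = p ^ N * w" by blast
  with zequiv_translate[OF m z, of s] that show thesis by metis
qed

text \<open>The forms \<open>(p\<^bsup>2k\<^esup> a, b, p\<^bsup>2(K-k)\<^esup> c)\<close> lie in one class over \<open>\<int>[1/m]\<close>. An integral equivalence between
  two of them would be a similarity of ratio at most \<open>p\<^bsup>2K\<^esup>\<close>, which is too small for
  the discriminant.\<close>

lemma definite_many:
  assumes m: "m > 0" and f: "bqf_disc f = 1 - 4 * m" and p: "prime p" "p dvd m"
    and big: "4 * p ^ (2 * K) * (bqf_content f)\<^sup>2 < 4 * m - 1"
  shows "\<exists>S. finite S \<and> card S = K \<and> (\<forall>g\<in>S. zequiv m f g \<and> is_reduced g)"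
proof -
  have m0: "m \<noteq> 0" using m by simp
  from lift_root[OF m0 f p, of "2 * K"] obtain a b c where z: "zequiv m f (a, b, p ^ (2 * K) * c)" .
  define F where "F k = (p ^ (2 * k) * a, b, p ^ (2 * (K - k)) * c)" for k
  have zF: "zequiv m f (F k)" if "k \<le> K" for k
  proof -
    have "2 * K = 2 * k + 2 * (K - k)" using that by simp
    then have eq: "p ^ (2 * K) * c = p ^ (2 * k) * (p ^ (2 * (K - k)) * c)"
      by (metis mult.assoc power_add)
    have "zequiv m (a, b, p ^ (2 * k) * (p ^ (2 * (K - k)) * c)) (F k)"
      unfolding F_def
      by (rule zequiv_scale[OF m0 _ p(2)]) (use zequiv_disc(2)[OF m0 z] in \<open>simp only: eq\<close>)
    with z show ?thesis unfolding eq by (rule zequiv_trans[OF m0])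
  qed
  \<comment> \<open>The reducing matrices are chosen together with the reduced forms, since the
    distinctness argument works with them.\<close>
  have "\<exists>P. \<forall>k\<le>K. case P k of (p, q, r, s) \<Rightarrow> p * s - q * r = 1 \<and>
      is_reduced (sub4 p q r s (F k)) \<and> zequiv m f (sub4 p q r s (F k))"
  proof (intro choice allI)
    fix k
    show "\<exists>y. k \<le> K \<longrightarrow> (case y of (p, q, r, s) \<Rightarrow> p * s - q * r = 1 \<and>
      is_reduced (sub4 p q r s (F k)) \<and> zequiv m f (sub4 p q r s (F k)))"
    proof (cases "k \<le> K")
      case True
      from definite_reduction[OF m zequiv_disc(2)[OF m0 zF[OF True]]] obtain p q r s
        where "p * s - q * r = 1" "is_reduced (sub4 p q r s (F k))"
          "zequiv m (F k) (sub4 p q r s (F k))" .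
      with zequiv_trans[OF m0 zF[OF True]] show ?thesis
        by (intro exI[of _ "(p, q, r, s)"]) auto
    qed auto
  qed
  then obtain P where P: "\<And>k. k \<le> K \<Longrightarrow> case P k of (p, q, r, s) \<Rightarrow> p * s - q * r = 1 \<and>
      is_reduced (sub4 p q r s (F k)) \<and> zequiv m f (sub4 p q r s (F k))" by blast
  define R where "R k = (case P k of (p, q, r, s) \<Rightarrow> sub4 p q r s (F k))" for k
  have R: "is_reduced (R k)" "zequiv m f (R k)" if "k \<le> K" for k
    using P[OF that] by (auto simp: R_def split: prod.splits)
  have neq: "R i \<noteq> R j" if "i < j" "j \<le> K" for i j
  proof
    assume eq: "R i = R j"
    obtain p1 q1 r1 s1 where 1: "P i = (p1, q1, r1, s1)" by (cases "P i")
    obtain p2 q2 r2 s2 where 2: "P j = (p2, q2, r2, s2)" by (cases "P j")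
    have d: "p1 * s1 - q1 * r1 = 1" "p2 * s2 - q2 * r2 = 1"
      using P[of i] P[of j] that by (auto simp: 1 2)
    define n where "n = p ^ (2 * (j - i))"
    define A C where "A = p ^ (2 * i) * a" and "C = p ^ (2 * (K - j)) * c"
    have p2: "p \<ge> 2" using p(1) by (simp add: prime_ge_2_int)
    have "2 * j = 2 * (j - i) + 2 * i" "2 * (K - i) = 2 * (j - i) + 2 * (K - j)" using that by simp_all
    then have Fij: "F i = (A, b, n * C)" "F j = (n * A, b, C)"
      by (simp_all only: F_def n_def A_def C_def power_add mult.assoc)
    have n1: "n > 1" using that p2 by (simp add: n_def one_less_power)
    have nK: "n \<le> p ^ (2 * K)" unfolding n_def using that p2 by (intro power_increasing) auto
    have smul: "sub4 p' q' r' s' (n * x, n * y, n * z) = (case sub4 p' q' r' s' (x, y, z) of (u, v, w) \<Rightarrow> (n * u, n * v, n * w))"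
      for p' q' r' s' x y z by (simp add: sub4_def algebra_simps)
    \<comment> \<open>The j-th reducing matrix times the inverse of the i-th: if the reductions
      coincide, it takes \<open>F j\<close> to \<open>F i\<close>.\<close>
    define p3 q3 r3 s3 where 3: "p3 = p2 * s1 + q2 * - r1" "q3 = p2 * - q1 + q2 * p1"
      "r3 = r2 * s1 + s2 * - r1" "s3 = r2 * - q1 + s2 * p1"
    have "F i = sub4 s1 (- q1) (- r1) p1 (R i)"
      using sub4_inverse[OF d(1)] by (simp add: R_def 1)
    also have "\<dots> = sub4 p3 q3 r3 s3 (n * A, b, C)"
      unfolding eq by (simp add: R_def 2 sub4_sub4 Fij 3)
    finally have "sub4 p3 q3 r3 s3 (n * A, b, C) = (A, b, n * C)" by (simp add: Fij)
    then have "sub4 p3 q3 r3 s3 (n * (n * A), n * b, n * C) = (n * A, n * b, n * (n * C))"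
      by (simp add: smul)
    \<comment> \<open>The matrix diag(n, 1) takes \<open>F i\<close> to n times \<open>F j\<close>.
      Followed by the matrix above it becomes a similarity of \<open>F i\<close> with ratio
      n.\<close>
    moreover have "(n * (n * A), n * b, n * C) = sub4 n 0 0 1 (A, b, n * C)"
      by (simp add: sub4_def power2_eq_square)
    ultimately have sim: "sub4 (n * p3) (n * q3) r3 s3 (A, b, n * C) = (n * A, n * b, n * (n * C))"
      by (simp add: sub4_sub4)
    have "p3 * s3 - q3 * r3 = (p1 * s1 - q1 * r1) * (p2 * s2 - q2 * r2)"
      by (simp add: 3 algebra_simps)
    then have d3: "p3 * s3 - q3 * r3 = 1" by (simp add: d)
    have "n * p3 * s3 - n * q3 * r3 = n * (p3 * s3 - q3 * r3)" by (simp add: algebra_simps)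
    then have det: "n = n * p3 * s3 - n * q3 * r3" by (simp add: d3)
    have zi: "zequiv m f (A, b, n * C)" using zF[of i] that by (simp add: Fij)
    have disc: "bqf_disc (A, b, n * C) = 1 - 4 * m" by (rule zequiv_disc(2)[OF m0 zi])
    have "A \<noteq> 0"
    proof
      assume "A = 0"
      then have "b\<^sup>2 = 1 - 4 * m" using disc by (simp add: bqf_disc_def)
      moreover have "b\<^sup>2 \<ge> 0" by simp
      ultimately show False using m by linarith
    qed
    \<comment> \<open>Otherwise \<open>similarity\<close> makes the matrix scalar on the diagonal,
      \<open>s3 = n * p3\<close>, and determinant 1 would read
      \<open>n * (p3 * p3) = 1\<close>.\<close>
    have "r3 \<noteq> 0"
    proof
      assume r3: "r3 = 0"
      with similarity[OF sim det] n1 \<open>A \<noteq> 0\<close> have "s3 = n * p3" by simp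
      with d3 r3 have "n * (p3 * p3) = 1" by (simp add: algebra_simps)
      then show False using n1 by (metis dvd_triv_left zdvd1_eq abs_of_pos less_irrefl less_trans zero_less_one)
    qed
    from similarity_disc_le[OF sim det _ this] n1
    have "4 * m - 1 \<le> 4 * n * (bqf_content (A, b, n * C))\<^sup>2" by (simp add: disc)
    also have "bqf_content (A, b, n * C) = bqf_content f" using bqf_content_zequiv[OF m0 zi] by simp
    also have "4 * n * (bqf_content f)\<^sup>2 \<le> 4 * p ^ (2 * K) * (bqf_content f)\<^sup>2"
      using nK by (intro mult_right_mono) auto
    finally show False using big by simp
  qed
  have "inj_on R {..<K}"
    by (rule linorder_inj_onI') (use neq in auto)
  then have "card (R ` {..<K}) = K" by (simp add: card_image)
  then show ?thesis using R by (intro exI[of _ "R ` {..<K}"]) auto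
qed

text \<open>Conway's river: the steps preserve the condition that the outer coefficients have opposite
  signs, and a return to an earlier form would be an automorph with small entries.\<close>

definition river_step :: "int bqf \<Rightarrow> int bqf" where
  "river_step = (\<lambda>(a, b, c). if (a + b + c) * c > 0 then (a, b + 2 * a, a + b + c)
     else (a + b + c, b + 2 * c, c))"

text \<open>Every step multiplies on the right by a unipotent matrix with entries 0 and 1. Nothing
  cancels among nonnegative entries, so row sums at most double and the product of at least one step
  is never the identity.\<close>

lemma river_iterate:
  "\<exists>p q r s. (river_step ^^ k) f = sub4 p q r s f \<and> p * s - q * r = 1 \<and>
     0 \<le> p \<and> 0 \<le> q \<and> 0 \<le> r \<and> 0 \<le> s \<and> p + q \<le> 2 ^ k \<and> r + s \<le> 2 ^ k \<and> (k > 0 \<longrightarrow> q + r > 0)"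
proof (induction k)
  case 0
  show ?case
    by (intro exI[of _ 1] exI[of _ 0]) (simp add: sub4_id)
next
  case (Suc k)
  then obtain p q r s where IH: "(river_step ^^ k) f = sub4 p q r s f" "p * s - q * r = 1"
    "0 \<le> p" "0 \<le> q" "0 \<le> r" "0 \<le> s" "p + q \<le> 2 ^ k" "r + s \<le> 2 ^ k" by blast
  \<comment> \<open>Positive diagonal entries are what makes an off-diagonal entry positive after
    the next step.\<close>
  have "p * s = 1 + q * r" "q * r \<ge> 0" using IH by simp_all
  then have "p * s > 0" by linarith
  then have ps: "p > 0" "s > 0" using IH by (auto simp: zero_less_mult_iff)
  obtain a b c where abc: "(river_step ^^ k) f = (a, b, c)" by (cases "(river_step ^^ k) f")
  have "(river_step ^^ Suc k) f = river_step (a, b, c)" by (simp add: abc)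
  moreover have "river_step (a, b, c) = sub4 1 1 0 1 (a, b, c) \<or>
      river_step (a, b, c) = sub4 1 0 1 1 (a, b, c)"
    by (simp add: river_step_def sub4_def algebra_simps)
  ultimately have "(river_step ^^ Suc k) f = sub4 1 1 0 1 (a, b, c) \<or>
      (river_step ^^ Suc k) f = sub4 1 0 1 1 (a, b, c)"
    by simp
  then show ?case
  proof
    assume "(river_step ^^ Suc k) f = sub4 1 1 0 1 (a, b, c)"
    then have "(river_step ^^ Suc k) f = sub4 p (p + q) r (r + s) f"
      by (simp add: sub4_sub4 IH(1) flip: abc)
    moreover have "p * (r + s) - (p + q) * r = 1" using IH(2) by (simp add: algebra_simps)
    ultimately show ?thesis using IH ps
      by (intro exI[of _ p] exI[of _ "p + q"] exI[of _ r] exI[of _ "r + s"]) auto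
  next
    assume "(river_step ^^ Suc k) f = sub4 1 0 1 1 (a, b, c)"
    then have "(river_step ^^ Suc k) f = sub4 (p + q) q (r + s) s f"
      by (simp add: sub4_sub4 IH(1) flip: abc)
    moreover have "(p + q) * s - q * (r + s) = 1" using IH(2) by (simp add: algebra_simps)
    ultimately show ?thesis using IH ps
      by (intro exI[of _ "p + q"] exI[of _ q] exI[of _ "r + s"] exI[of _ s]) auto
  qed
qed

text \<open>The hypothesis \<open>big\<close> acts twice: no form of the class has a vanishing outer
  coefficient, so the river never stops, and a return within K steps would give an automorph with
  \<open>\<bar>r\<bar> \<le> 2 ^ K\<close> and hence a leading coefficient that is too
  small.\<close>

lemma indefinite_many:
  assumes m: "m \<noteq> 0" and z: "zequiv m f (a, b, c)" "a * c < 0"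
    and big: "\<And>a' b' c'. zequiv m f (a', b', c') \<Longrightarrow> 2 ^ K * bqf_content f < \<bar>a'\<bar>"
  shows "\<exists>S. finite S \<and> card S = K \<and> (\<forall>g\<in>S. zequiv m f g \<and> (case g of (a, b, c) \<Rightarrow> a * c < 0))"
proof -
  define F where "F k = (river_step ^^ k) (a, b, c)" for k
  have F: "zequiv m f (F k) \<and> (case F k of (a, b, c) \<Rightarrow> a * c < 0)" for k
  proof (induction k)
    case 0
    show ?case using z by (simp add: F_def)
  next
    case (Suc k)
    obtain a b c where abc: "F k = (a, b, c)" by (cases "F k")
    have FS: "F (Suc k) = river_step (a, b, c)" using abc by (simp add: F_def)
    have zk: "zequiv m f (a, b, c)" "a * c < 0" using Suc abc by auto
    note disc = zequiv_disc(2)[OF m zk(1)]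
    have "zequiv m f (a + b + c, b + 2 * c, c)"
      using zequiv_trans[OF m zk(1) zequiv_sub4[OF m disc, of 1 1 0 1]]
      by (simp add: sub4_def algebra_simps)
    moreover have "zequiv m f (a, b + 2 * a, a + b + c)"
      using zequiv_trans[OF m zk(1) zequiv_sub4[OF m disc, of 1 1 1 0]]
      by (simp add: sub4_def algebra_simps)
    ultimately have zS: "zequiv m f (F (Suc k))" by (simp add: FS river_step_def)
    have "0 \<le> 2 ^ K * bqf_content f" using bqf_content_nonneg by simp
    with big[OF \<open>zequiv m f (a + b + c, b + 2 * c, c)\<close>] have "a + b + c \<noteq> 0" by linarith
    moreover have "c \<noteq> 0" using zk(2) by auto
    ultimately have "(a + b + c) * c > 0 \<or> (a + b + c) * c < 0"
      by (metis linorder_neqE_linordered_idom mult_eq_0_iff)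
    then have "case F (Suc k) of (a, b, c) \<Rightarrow> a * c < 0"
      unfolding FS river_step_def using zk(2)
      by (auto simp: mult_less_0_iff zero_less_mult_iff)
    with zS show ?case by blast
  qed
  have neq: "F i \<noteq> F j" if "i < j" "j \<le> K" for i j
  proof
    assume eq: "F i = F j"
    obtain a b c where abc: "F i = (a, b, c)" by (cases "F i")
    have "F j = (river_step ^^ (j - i)) (F i)"
      using that by (simp add: F_def flip: funpow_add[unfolded o_def, THEN fun_cong])
    then have return: "(river_step ^^ (j - i)) (a, b, c) = (a, b, c)" using eq abc by simp
    obtain p q r s where "(river_step ^^ (j - i)) (a, b, c) = sub4 p q r s (a, b, c)"
      and A: "p * s - q * r = 1" "0 \<le> q" "0 \<le> r" "0 \<le> s" "r + s \<le> 2 ^ (j - i)" "q + r > 0"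
      using river_iterate[of "j - i" "(a, b, c)"] \<open>i < j\<close> by auto
    have sim: "sub4 p q r s (a, b, c) = (1 * a, 1 * b, 1 * c)"
      using return \<open>_ = sub4 p q r s (a, b, c)\<close> by simp
    have a: "a \<noteq> 0" using F[of i] abc by auto
    \<comment> \<open>If r were 0, then \<open>a * q = 0\<close> and so \<open>q = 0\<close>,
      against \<open>q + r > 0\<close>.\<close>
    have r: "r \<noteq> 0"
      using similarity[OF sim A(1)[symmetric]] a A(6) by auto
    have zi: "zequiv m f (a, b, c)" using F[of i] abc by auto
    have "\<bar>a\<bar> \<le> \<bar>r\<bar> * bqf_content (a, b, c)"
      by (rule similarity_lead_le[OF sim A(1)[symmetric] _ r]) simp
    also have "bqf_content (a, b, c) = bqf_content f" using bqf_content_zequiv[OF m zi] by simp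
    also have "\<bar>r\<bar> * bqf_content f \<le> 2 ^ K * bqf_content f"
    proof (rule mult_right_mono)
      have "(2::int) ^ (j - i) \<le> 2 ^ K" using that by (intro power_increasing) auto
      then show "\<bar>r\<bar> \<le> 2 ^ K" using A by linarith
    qed (rule bqf_content_nonneg)
    finally show False using big[OF zi] by simp
  qed
  have "inj_on F {..<K}"
    by (rule linorder_inj_onI') (use neq in auto)
  then have "card (F ` {..<K}) = K" by (simp add: card_image)
  then show ?thesis using F by (intro exI[of _ "F ` {..<K}"]) auto
qed

section \<open>Parameters without small prime factors\<close>

lemma sum_inverse_smooth_le:
  fixes A F :: "nat set"
  assumes "finite A" "\<And>p. p \<in> A \<Longrightarrow> prime p" "finite F" "\<And>n. n \<in> F \<Longrightarrow> n > 0 \<and> prime_factors n \<subseteq> A"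
  shows "(\<Sum>n\<in>F. 1 / real n) \<le> (\<Prod>p\<in>A. 1 / (1 - 1 / real p))"
  using assms
proof (induction A arbitrary: F rule: finite_induct)
  case empty
  have "n = 1" if "n \<in> F" for n
  proof (rule ccontr)
    assume "n \<noteq> 1"
    then obtain q where "prime q" "q dvd n" using prime_factor_nat by blast
    moreover have "n > 0" "prime_factors n = {}" using empty(3)[OF that] by simp_all
    ultimately show False using prime_factorsI[of n q] by (metis empty_iff less_irrefl)
  qed
  then have "F \<subseteq> {1}" by blast
  then have "F = {} \<or> F = {1}" by (rule subset_singletonD)
  then show ?case by (elim disjE) simp_all
next
  case (insert p A)
  have p: "prime p" using insert.prems by simp
  define e where "e n = multiplicity p n" for n
  define r where "r n = n div p ^ e n" for n
  have er: "p ^ e n * r n = n" for n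
    unfolding r_def e_def by (simp add: multiplicity_dvd)
  have r: "r n > 0 \<and> prime_factors (r n) \<subseteq> A" if "n \<in> F" for n
  proof -
    have n: "n > 0" "prime_factors n \<subseteq> insert p A" using insert.prems(3)[OF that] by auto
    have "p ^ e n * r n > 0" using n(1) by (simp only: er)
    then have "r n > 0" by simp
    moreover have "\<not> p dvd r n"
      using multiplicity_decompose[of n p] n(1) prime_gt_1_nat[OF p]
      by (simp add: r_def e_def)
    moreover have "prime_factors (r n) \<subseteq> prime_factors n"
    proof (rule dvd_prime_factors)
      have "r n dvd p ^ e n * r n" by simp
      then show "r n dvd n" by (simp only: er)
    qed (use n(1) in simp)
    ultimately show ?thesis using n(2) by (auto simp: in_prime_factors_iff)
  qed
  define E where "E = Max (insert 0 (e ` F))"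
  have eE: "e n \<le> E" if "n \<in> F" for n using that insert.prems(2) by (simp add: E_def)
  have p2: "real p \<ge> 2" using prime_ge_2_nat[OF p] by simp
  have inj: "inj_on (\<lambda>n. (e n, r n)) F"
  proof (rule inj_onI)
    fix x y assume "(e x, r x) = (e y, r y)"
    then have "p ^ e x * r x = p ^ e y * r y" by simp
    then show "x = y" by (simp only: er)
  qed
  have "(\<Sum>n\<in>F. 1 / real n) = (\<Sum>n\<in>F. (1 / real p) ^ e n * (1 / real (r n)))"
  proof (rule sum.cong[OF refl])
    fix n
    have "real n = real (p ^ e n * r n)" by (simp only: er)
    also have "\<dots> = real p ^ e n * real (r n)" by simp
    finally show "1 / real n = (1 / real p) ^ e n * (1 / real (r n))"
      by (simp only: power_divide) simp
  qed
  also have "\<dots> = (\<Sum>(k, n)\<in>(\<lambda>n. (e n, r n)) ` F. (1 / real p) ^ k * (1 / real n))"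
    by (subst sum.reindex[OF inj]) simp
  also have "\<dots> \<le> (\<Sum>(k, n)\<in>{..E} \<times> r ` F. (1 / real p) ^ k * (1 / real n))"
    using insert.prems(2) eE by (intro sum_mono2) auto
  also have "\<dots> = (\<Sum>k\<le>E. (1 / real p) ^ k) * (\<Sum>n\<in>r ` F. 1 / real n)"
    by (simp add: sum_product sum.cartesian_product)
  also have "\<dots> \<le> 1 / (1 - 1 / real p) * (\<Prod>p\<in>A. 1 / (1 - 1 / real p))"
  proof (rule mult_mono)
    have s: "summable (\<lambda>k. (1 / real p) ^ k)" using p2 by (intro summable_geometric) simp
    have "(\<Sum>k\<le>E. (1 / real p) ^ k) \<le> (\<Sum>k. (1 / real p) ^ k)"
      by (intro sum_le_suminf s) auto
    also have "\<dots> = 1 / (1 - 1 / real p)" using p2 by (intro suminf_geometric) simp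
    finally show "(\<Sum>k\<le>E. (1 / real p) ^ k) \<le> 1 / (1 - 1 / real p)" .
    show "(\<Sum>n\<in>r ` F. 1 / real n) \<le> (\<Prod>p\<in>A. 1 / (1 - 1 / real p))"
      by (rule insert.IH) (use insert.prems r in auto)
  qed (use p2 in \<open>auto intro: sum_nonneg\<close>)
  finally show ?case using insert.hyps by simp
qed

text \<open>All integers up to P have only prime factors up to P, so the reciprocal of the product
  is at least the harmonic number of P, which is unbounded.\<close>

lemma primes_product_small:
  assumes "\<delta> > (0::real)"
  shows "\<exists>P. (\<Prod>p | prime p \<and> p \<le> P. 1 - 1 / real p) < \<delta>"
proof -
  have "\<forall>\<^sub>F n in sequentially. 1 / \<delta> < (harm n :: real)"
    using harm_at_top by (simp add: filterlim_at_top_dense)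
  then obtain P where P: "1 / \<delta> < (harm P :: real)"
    by (auto simp: eventually_sequentially)
  define A where "A = {p. prime p \<and> p \<le> P}"
  have fin: "finite A" by (rule finite_subset[of _ "{..P}"]) (auto simp: A_def)
  have "harm P = (\<Sum>n=1..P. 1 / real n)" by (simp add: harm_def divide_inverse)
  also have "\<dots> \<le> (\<Prod>p\<in>A. 1 / (1 - 1 / real p))"
  proof (rule sum_inverse_smooth_le[OF fin])
    show "n > 0 \<and> prime_factors n \<subseteq> A" if "n \<in> {1..P}" for n
    proof -
      have "q \<le> n" if "q dvd n" for q
        using dvd_imp_le[OF that] \<open>n \<in> {1..P}\<close> by auto
      moreover have "n > 0" "n \<le> P" using that by simp_all
      ultimately show ?thesis unfolding A_def in_prime_factors_iff using order_trans by blast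
    qed
  qed (auto simp: A_def)
  also have "\<dots> = 1 / (\<Prod>p\<in>A. 1 - 1 / real p)" by (simp add: prod_dividef)
  finally have *: "1 / \<delta> < 1 / (\<Prod>p\<in>A. 1 - 1 / real p)" using P by simp
  have "(\<Prod>p\<in>A. 1 - 1 / real p) > 0"
    by (rule prod_pos) (auto simp: A_def dest!: prime_gt_1_nat)
  with * assms show ?thesis by (auto simp: field_simps A_def)
qed

text \<open>The value at \<open>(a, \<beta>, c)\<close> is the parameter \<open>m\<close> of the form \<open>(a, 2 \<beta> + 1, c)\<close> of discriminant \<open>1 - 4 m\<close>.\<close>

definition sieve_form :: "int \<times> int \<times> int \<Rightarrow> int" where
  "sieve_form = (\<lambda>(a, b, c). a * c - b\<^sup>2 - b)"

definition unsieved :: "nat set \<Rightarrow> int set \<Rightarrow> (int \<times> int \<times> int) set" where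
  "unsieved A I = {t \<in> I \<times> I \<times> I. \<forall>p\<in>A. \<not> int p dvd sieve_form t}"

lemma sieve_form_mod:
  assumes "d dvd n"
  shows "d dvd sieve_form (a mod n, b mod n, c mod n) \<longleftrightarrow> d dvd sieve_form (a, b, c)"
proof -
  have *: "[x mod n = x] (mod d)" for x using assms by (simp add: cong_def mod_mod_cancel)
  have "[sieve_form (a mod n, b mod n, c mod n) = sieve_form (a, b, c)] (mod d)"
    unfolding sieve_form_def prod.case by (intro cong_diff cong_mult cong_pow *)
  then show ?thesis by (rule cong_dvd_iff)
qed

text \<open>At least \<open>p^2\<close> residue triples solve \<open>a * c = b^2 + b\<close> modulo
  p: one c for each b and each nonzero a, and every c for \<open>a = b = 0\<close>. The solutions
  with \<open>a = 0\<close>, \<open>b = -1\<close> are ignored, as \<open>p^2\<close> already gives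
  the factor \<open>1 - 1 / p\<close>.\<close>

lemma card_unsieved_prime:
  assumes p: "prime p"
  shows "real (card (unsieved {p} {0..<int p})) \<le> real p ^ 3 * (1 - 1 / real p)"
proof -
  define I where "I = {0..<int p}"
  have pp: "prime (int p)" "int p > 0" using p by (auto simp: prime_gt_0_nat)
  have "\<exists>z. z \<in> I \<and> int p dvd sieve_form (x, y, z)" if "x \<in> I" "x \<noteq> 0" for x y
  proof -
    have "\<not> int p dvd x" using that zdvd_not_zless[of x "int p"] by (auto simp: I_def)
    then have "coprime x (int p)" using pp(1) prime_imp_coprime coprime_commute by blast
    then obtain w where w: "[x * w = 1] (mod int p)" using cong_solve_coprime_int by blast
    define z where "z = (w * (y\<^sup>2 + y)) mod int p"
    have "[x * z = x * (w * (y\<^sup>2 + y))] (mod int p)" by (simp add: z_def cong_def mod_mult_right_eq)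
    also have "x * (w * (y\<^sup>2 + y)) = (x * w) * (y\<^sup>2 + y)" by simp
    also have "[(x * w) * (y\<^sup>2 + y) = 1 * (y\<^sup>2 + y)] (mod int p)" by (intro cong_scalar_right w)
    finally have "int p dvd x * z - (y\<^sup>2 + y)" by (simp add: cong_iff_dvd_diff)
    moreover have "z \<in> I" using pp(2) by (simp add: z_def I_def)
    ultimately show ?thesis by (auto simp: sieve_form_def algebra_simps)
  qed
  then obtain Z where Z: "\<And>x y. x \<in> I \<Longrightarrow> x \<noteq> 0 \<Longrightarrow> Z x y \<in> I \<and> int p dvd sieve_form (x, y, Z x y)"
    by metis
  define g where "g = (\<lambda>(x, y). if x = 0 then (0, 0, y) else (x, y, Z x y))"
  have "inj_on g (I \<times> I)" by (auto simp: inj_on_def g_def split: if_splits)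
  then have card_g: "card (g ` (I \<times> I)) = p * p" by (simp add: card_image card_cartesian_product I_def)
  have I0: "0 \<in> I" using pp(2) by (simp add: I_def)
  have g: "g t \<in> I \<times> I \<times> I \<and> int p dvd sieve_form (g t)" if "t \<in> I \<times> I" for t
  proof -
    obtain x y where t: "t = (x, y)" "x \<in> I" "y \<in> I" using \<open>t \<in> I \<times> I\<close> by blast
    show ?thesis
    proof (cases "x = 0")
      case True
      then show ?thesis using t I0 by (simp add: g_def sieve_form_def)
    next
      case False
      then show ?thesis using t Z[OF t(2) False] by (simp add: g_def)
    qed
  qed
  then have sub: "g ` (I \<times> I) \<subseteq> I \<times> I \<times> I" by blast
  have "unsieved {p} I \<subseteq> I \<times> I \<times> I - g ` (I \<times> I)"
  proof
    fix t assume "t \<in> unsieved {p} I"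
    then have "t \<in> I \<times> I \<times> I" "\<not> int p dvd sieve_form t" by (simp_all add: unsieved_def)
    with g show "t \<in> I \<times> I \<times> I - g ` (I \<times> I)" by blast
  qed
  then have "card (unsieved {p} I) \<le> card (I \<times> I \<times> I - g ` (I \<times> I))"
    by (intro card_mono) (auto simp: I_def)
  also have "\<dots> = card (I \<times> I \<times> I) - card (g ` (I \<times> I))"
    by (rule card_Diff_subset[OF _ sub]) (simp add: I_def)
  also have "\<dots> = p * (p * p) - p * p"
    by (simp add: card_g card_cartesian_product) (simp add: I_def)
  finally have "card (unsieved {p} I) \<le> p * (p * p) - p * p" .
  moreover have "p * p \<le> p * (p * p)" using pp(2) by simp
  ultimately have "real (card (unsieved {p} I)) \<le> real p * (real p * real p) - real p * real p"
    by (metis (mono_tags) of_nat_diff of_nat_le_iff of_nat_mult)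
  also have "\<dots> = real p ^ 3 * (1 - 1 / real p)"
    using pp(2) by (simp add: power3_eq_cube algebra_simps)
  finally show ?thesis by (simp add: I_def)
qed

lemma finite_unsieved: "finite I \<Longrightarrow> finite (unsieved A I)"
  by (simp add: unsieved_def)

text \<open>Chinese remaindering: a triple modulo \<open>p * M\<close> is determined by its residues
  modulo M and p, and each condition depends on one of them only.\<close>

lemma card_unsieved_modulus:
  assumes "finite A" "\<And>p. p \<in> A \<Longrightarrow> prime p"
  shows "real (card (unsieved A {0..<int (\<Prod>A)})) \<le> real (\<Prod>A) ^ 3 * (\<Prod>p\<in>A. 1 - 1 / real p)"
  using assms
proof (induction A rule: finite_induct)
  case empty
  have "unsieved {} {0..<1} \<subseteq> {(0, 0, 0)}" by (auto simp: unsieved_def)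
  then have "card (unsieved {} {0..<1}) \<le> card {(0::int, 0::int, 0::int)}" by (intro card_mono) auto
  then show ?case by simp
next
  case (insert p A)
  define M where "M = \<Prod>A"
  have p: "prime p" using insert.prems by simp
  have M: "M > 0" unfolding M_def
    by (rule prod_pos) (use insert.prems prime_gt_0_nat in blast)
  have cop: "coprime M p"
    unfolding M_def
  proof (rule prod_coprime_left)
    fix q assume "q \<in> A"
    then show "coprime q p" using insert.hyps(2) insert.prems by (intro primes_coprime) auto
  qed
  have MI: "\<Prod>(insert p A) = p * M" using insert.hyps by (simp add: M_def)
  define h where "h n = (\<lambda>(a, b, c). (a mod int n, b mod int n, c mod int n))" for n
  have inj: "inj_on (\<lambda>t. (h M t, h p t)) (unsieved (insert p A) {0..<int (p * M)})"
  proof (rule inj_onI)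
    fix t t' assume t: "t \<in> unsieved (insert p A) {0..<int (p * M)}"
      "t' \<in> unsieved (insert p A) {0..<int (p * M)}" "(h M t, h p t) = (h M t', h p t')"
    have *: "x = y" if "x \<in> {0..<int (p * M)}" "y \<in> {0..<int (p * M)}"
      "x mod int M = y mod int M" "x mod int p = y mod int p" for x y
    proof -
      have "[x = y] (mod (int M * int p))"
        using that cop by (intro coprime_cong_mult) (auto simp: cong_def)
      then show ?thesis using that by (intro cong_less_imp_eq_int[of x "int M * int p" y]) (auto simp: mult.commute)
    qed
    obtain a b c a' b' c' where abc: "t = (a, b, c)" "t' = (a', b', c')" by (cases t; cases t')
    have "a = a'" "b = b'" "c = c'"
      by (rule *; use t in \<open>simp add: abc unsieved_def h_def\<close>)+
    then show "t = t'" by (simp add: abc)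
  qed
  have sub: "(\<lambda>t. (h M t, h p t)) ` unsieved (insert p A) {0..<int (p * M)} \<subseteq>
      unsieved A {0..<int M} \<times> unsieved {p} {0..<int p}"
  proof -
    have "q dvd M" if "q \<in> A" for q
      unfolding M_def using insert.hyps(1) that by (rule dvd_prodI)
    then show ?thesis using M prime_gt_0_nat[OF p]
      by (auto simp: unsieved_def h_def sieve_form_mod)
  qed
  have "card (unsieved (insert p A) {0..<int (p * M)}) \<le>
      card (unsieved A {0..<int M} \<times> unsieved {p} {0..<int p})"
    by (rule card_inj_on_le[OF inj sub]) (simp add: finite_unsieved)
  then have "real (card (unsieved (insert p A) {0..<int (p * M)})) \<le>
      real (card (unsieved A {0..<int M})) * real (card (unsieved {p} {0..<int p}))"
    by (metis card_cartesian_product of_nat_le_iff of_nat_mult)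
  also have "\<dots> \<le> (real M ^ 3 * (\<Prod>p\<in>A. 1 - 1 / real p)) * (real p ^ 3 * (1 - 1 / real p))"
    using insert.IH insert.prems card_unsieved_prime[OF p]
    by (intro mult_mono) (auto simp: M_def intro!: prod_nonneg mult_nonneg_nonneg)
  finally show ?case using insert.hyps unfolding MI
    by (simp add: power_mult_distrib algebra_simps)
qed

lemma unsieved_box:
  assumes "\<delta> > 0"
  shows "\<exists>P Y0. \<forall>Y\<ge>Y0. real (card (unsieved {p. prime p \<and> p \<le> P} {-Y..Y})) \<le> \<delta> * real_of_int Y ^ 3"
proof -
  \<comment> \<open>The box meets at most \<open>2 * Q + 2 \<le> 4 * Y / M\<close> blocks of length
    M in each direction; the cube of 4 is 64.\<close>
  have "\<delta> / 64 > 0" using assms by simp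
  from primes_product_small[OF this] obtain P
    where P: "(\<Prod>p | prime p \<and> p \<le> P. 1 - 1 / real p) < \<delta> / 64" by blast
  define A where "A = {p. prime p \<and> p \<le> P}"
  have fin: "finite A" by (rule finite_subset[of _ "{..P}"]) (auto simp: A_def)
  define M where "M = \<Prod>A"
  have M: "M > 0" unfolding M_def by (rule prod_pos) (simp add: A_def prime_gt_0_nat)
  have "real (card (unsieved A {-Y..Y})) \<le> \<delta> * real_of_int Y ^ 3" if Y: "Y \<ge> int M" for Y
  proof -
    define Q where "Q = Y div int M"
    define h where "h = (\<lambda>(a, b, c). (a mod int M, b mod int M, c mod int M))"
    define d where "d = (\<lambda>(a, b, c). (a div int M, b div int M, c div int M))"
    have inj: "inj_on (\<lambda>t. (h t, d t)) (unsieved A {-Y..Y})"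
    proof (rule inj_onI)
      have *: "x = y" if "x mod int M = y mod int M" "x div int M = y div int M" for x y
        using that by (metis div_mult_mod_eq)
      fix t t' assume t: "(h t, d t) = (h t', d t')"
      obtain a b c a' b' c' where abc: "t = (a, b, c)" "t' = (a', b', c')" by (cases t; cases t')
      have "a = a'" "b = b'" "c = c'"
        by (rule *; use t in \<open>simp add: abc h_def d_def\<close>)+
      then show "t = t'" by (simp add: abc)
    qed
    \<comment> \<open>Rounding down makes the lowest block \<open>-Q-1\<close> when M does not
      divide Y, hence \<open>2 * Q + 2\<close> possible blocks.\<close>
    have dQ: "x div int M \<in> {-Q-1..Q}" if "x \<in> {-Y..Y}" for x
    proof -
      have "x div int M \<le> Q" unfolding Q_def using that M by (intro zdiv_mono1) auto
      moreover have "(- Y) div int M \<le> x div int M" using that M by (intro zdiv_mono1) auto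
      moreover have "- Q - 1 \<le> (- Y) div int M"
        unfolding Q_def using M by (simp add: zdiv_zminus1_eq_if)
      ultimately show ?thesis by auto
    qed
    have qM: "int q dvd int M" if "q \<in> A" for q
      unfolding M_def int_dvd_int_iff using fin that by (rule dvd_prodI)
    have sub: "(\<lambda>t. (h t, d t)) ` unsieved A {-Y..Y} \<subseteq>
        unsieved A {0..<int M} \<times> ({-Q-1..Q} \<times> {-Q-1..Q} \<times> {-Q-1..Q})"
    proof (rule image_subsetI)
      fix t assume t: "t \<in> unsieved A {-Y..Y}"
      obtain a b c where abc: "t = (a, b, c)" by (cases t)
      have "h t \<in> unsieved A {0..<int M}"
        using t M sieve_form_mod[OF qM, of _ a b c] by (simp add: abc h_def unsieved_def)
      moreover have "d t \<in> {-Q-1..Q} \<times> {-Q-1..Q} \<times> {-Q-1..Q}"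
        using t unfolding abc d_def unsieved_def by (simp only: prod.case mem_Collect_eq mem_Times_iff fst_conv snd_conv dQ)
      ultimately show "(h t, d t) \<in> unsieved A {0..<int M} \<times> ({-Q-1..Q} \<times> {-Q-1..Q} \<times> {-Q-1..Q})"
        by blast
    qed
    have "card (unsieved A {-Y..Y}) \<le>
        card (unsieved A {0..<int M} \<times> ({-Q-1..Q} \<times> {-Q-1..Q} \<times> {-Q-1..Q}))"
      by (rule card_inj_on_le[OF inj sub]) (simp add: finite_unsieved)
    also have "\<dots> = card (unsieved A {0..<int M}) * nat (2 * Q + 2) ^ 3"
      by (simp add: card_cartesian_product power3_eq_cube algebra_simps)
    finally have "real (card (unsieved A {-Y..Y})) \<le>
        real (card (unsieved A {0..<int M})) * real (nat (2 * Q + 2)) ^ 3"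
      by (metis of_nat_le_iff of_nat_mult of_nat_power)
    also have "\<dots> \<le> (real M ^ 3 * (\<delta> / 64)) * (4 * real_of_int Y / real M) ^ 3"
    proof (intro mult_mono power_mono)
      have "real (card (unsieved A {0..<int M})) \<le> real M ^ 3 * (\<Prod>p\<in>A. 1 - 1 / real p)"
        unfolding M_def by (rule card_unsieved_modulus[OF fin]) (simp add: A_def)
      also have "\<dots> \<le> real M ^ 3 * (\<delta> / 64)" using P by (intro mult_left_mono) (auto simp: A_def)
      finally show "real (card (unsieved A {0..<int M})) \<le> real M ^ 3 * (\<delta> / 64)" .
      have "Q \<ge> 1" using Y M unfolding Q_def by (simp add: pos_imp_zdiv_pos_iff int_one_le_iff_zero_less)
      then have "real (nat (2 * Q + 2)) \<le> 4 * real_of_int Q" by simp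
      also have "real_of_int Q \<le> real_of_int Y / real M"
        unfolding Q_def using real_of_int_div4[of Y "int M"] by simp
      finally show "real (nat (2 * Q + 2)) \<le> 4 * real_of_int Y / real M" by simp
    qed (use assms in auto)
    also have "\<dots> = \<delta> * real_of_int Y ^ 3"
      using M by (simp add: power_mult_distrib power_divide)
    finally show ?thesis .
  qed
  then show ?thesis
    unfolding A_def by (intro exI[of _ P] exI[of _ "int M"] allI impI)
qed

section \<open>Counting forms in thin sets\<close>

lemma card_int_interval_le:
  fixes l u :: real
  assumes "l \<le> u + 1"
  shows "finite {c::int. l \<le> of_int c \<and> of_int c \<le> u}"
    "real (card {c::int. l \<le> of_int c \<and> of_int c \<le> u}) \<le> u - l + 1"
proof -
  have eq: "{c::int. l \<le> of_int c \<and> of_int c \<le> u} = {\<lceil>l\<rceil>..\<lfloor>u\<rfloor>}"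
    by (auto simp: ceiling_le_iff le_floor_iff)
  show "finite {c::int. l \<le> of_int c \<and> of_int c \<le> u}" by (simp add: eq)
  have "real_of_int \<lfloor>u\<rfloor> \<le> u" "l \<le> real_of_int \<lceil>l\<rceil>" by simp_all
  then have le: "real_of_int (\<lfloor>u\<rfloor> - \<lceil>l\<rceil> + 1) \<le> u - l + 1"
    unfolding of_int_add of_int_diff of_int_1 by linarith
  have "real (nat (\<lfloor>u\<rfloor> - \<lceil>l\<rceil> + 1)) \<le> u - l + 1"
  proof (cases "\<lfloor>u\<rfloor> - \<lceil>l\<rceil> + 1 \<ge> 0")
    case True
    then show ?thesis using le by (simp only: of_nat_nat)
  next
    case False
    then have "nat (\<lfloor>u\<rfloor> - \<lceil>l\<rceil> + 1) = 0" by simp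
    then show ?thesis using assms by (simp only: of_nat_0)
  qed
  then show "real (card {c::int. l \<le> of_int c \<and> of_int c \<le> u}) \<le> u - l + 1"
    by (simp add: eq algebra_simps)
qed

text \<open>With \<open>a = 0\<close> the discriminant is \<open>b^2\<close>, and
  \<open>\<bar>1 - 4 * m\<bar> \<le> 5 * X\<close> for X at least 1. These representatives number
  only O(X).\<close>

lemma card_isotropic_forms:
  assumes X: "X \<ge> (1::real)"
  defines "S \<equiv> {(a, b, c). (a::int) = 0 \<and> real_of_int (b\<^sup>2) \<le> 5 * X \<and> 0 \<le> c \<and> c < \<bar>b\<bar>}"
  shows "finite S" "real (card S) \<le> 30 * X"
proof -
  define N where "N = sqrt (5 * X)"
  define n where "n = \<lfloor>N\<rfloor>"
  have N: "N \<ge> 1" "N\<^sup>2 = 5 * X" using X by (simp_all add: N_def real_le_rsqrt)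
  have n: "n \<ge> 1" "real_of_int n \<le> N" using N(1) by (simp_all add: n_def le_floor_iff)
  have "S \<subseteq> {0} \<times> {-n..n} \<times> {0..n}"
  proof
    fix t assume "t \<in> S"
    then obtain b c where t: "t = (0, b, c)" "real_of_int (b\<^sup>2) \<le> 5 * X" "0 \<le> c" "c < \<bar>b\<bar>"
      by (auto simp: S_def)
    have "\<bar>real_of_int b\<bar> \<le> N" using t(2) unfolding N_def by (intro real_le_rsqrt) simp
    then have "\<bar>b\<bar> \<le> n" unfolding n_def by (simp add: le_floor_iff)
    with t show "t \<in> {0} \<times> {-n..n} \<times> {0..n}" by auto
  qed
  moreover have fin: "finite ({0::int} \<times> {-n..n} \<times> {0..n})" by simp
  ultimately show "finite S" by (rule finite_subset)
  have "card S \<le> card ({0::int} \<times> {-n..n} \<times> {0..n})"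
    by (rule card_mono) fact+
  also have "\<dots> = nat (2 * n + 1) * nat (n + 1)" using n by (simp add: card_cartesian_product)
  finally have "real (card S) \<le> real (nat (2 * n + 1)) * real (nat (n + 1))"
    by (metis of_nat_le_iff of_nat_mult)
  also have "\<dots> \<le> (3 * N) * (2 * N)"
    using n N by (intro mult_mono) auto
  also have "\<dots> = 30 * X" using N(2) by (simp add: power2_eq_square)
  finally show "real (card S) \<le> 30 * X" .
qed

text \<open>For given a and b, the last coefficient runs through an interval of length
  \<open>2 * X / \<bar>a\<bar>\<close>, while b takes at most \<open>3 * \<bar>a\<bar>\<close>
  values. The factor \<open>\<bar>a\<bar>\<close> cancels: each a contributes at most
  \<open>9 * X\<close>, and there are at most \<open>2 * \<epsilon> * sqrt X\<close> of
  them.\<close>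

lemma card_small_lead:
  assumes X: "X \<ge> (1::real)" and \<epsilon>: "0 < \<epsilon>" "\<epsilon> \<le> 1"
  defines "S \<equiv> {(a, b, c). (a::int) \<noteq> 0 \<and> real_of_int \<bar>a\<bar> \<le> \<epsilon> * sqrt X \<and> \<bar>b\<bar> \<le> \<bar>a\<bar> \<and>
    real_of_int \<bar>b\<^sup>2 - 4 * a * c - 1\<bar> \<le> 4 * X}"
  shows "finite S" "real (card S) \<le> 18 * \<epsilon> * (sqrt X) ^ 3"
proof -
  define n where "n = \<lfloor>\<epsilon> * sqrt X\<rfloor>"
  define A where "A = {-n..n} - {0}"
  define J where "J a b = {c::int. (of_int b ^ 2 - 1) / (4 * of_int a) - X / of_int \<bar>a\<bar> \<le> of_int c \<and>
      of_int c \<le> (of_int b ^ 2 - 1) / (4 * of_int a) + X / of_int \<bar>a\<bar>}" for a b :: int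
  have sX: "sqrt X \<ge> 1" "sqrt X * sqrt X = X" using X by simp_all
  have n0: "n \<ge> 0" "real_of_int n \<le> \<epsilon> * sqrt X" using \<epsilon> sX by (auto simp: n_def)
  have finA: "finite A" by (simp add: A_def)
  have cardA: "real (card A) = 2 * real_of_int n"
    using n0 by (simp add: A_def card_Diff_subset)
  have J: "finite (J a b)" "real (card (J a b)) \<le> 2 * X / real_of_int \<bar>a\<bar> + 1" for a b
  proof -
    have "X / real_of_int \<bar>a\<bar> \<ge> 0" using X by simp
    then have "(of_int b ^ 2 - 1) / (4 * of_int a) - X / of_int \<bar>a\<bar> \<le>
      (of_int b ^ 2 - 1) / (4 * of_int a) + X / of_int \<bar>a\<bar> + (1::real)" by simp
    from card_int_interval_le[OF this] show "finite (J a b)"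
      "real (card (J a b)) \<le> 2 * X / real_of_int \<bar>a\<bar> + 1" unfolding J_def by simp_all
  qed
  have sub: "S \<subseteq> (SIGMA a:A. SIGMA b:{-\<bar>a\<bar>..\<bar>a\<bar>}. J a b)"
  proof
    fix t assume "t \<in> S"
    then obtain a b c where t: "t = (a, b, c)" "a \<noteq> 0" "real_of_int \<bar>a\<bar> \<le> \<epsilon> * sqrt X" "\<bar>b\<bar> \<le> \<bar>a\<bar>"
      "real_of_int \<bar>b\<^sup>2 - 4 * a * c - 1\<bar> \<le> 4 * X"
      by (auto simp: S_def)
    have "\<bar>a\<bar> \<le> n" using t(3) by (simp add: n_def le_floor_iff)
    moreover have "c \<in> J a b"
    proof -
      define z where "z = (real_of_int b ^ 2 - 1) / (4 * of_int a) - of_int c"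
      have "4 * real_of_int a * z = of_int (b\<^sup>2 - 4 * a * c - 1)"
        using t(2) by (simp add: z_def field_simps)
      then have "\<bar>4 * real_of_int a * z\<bar> \<le> 4 * X" using t(5) by simp
      then have "real_of_int \<bar>a\<bar> * \<bar>z\<bar> \<le> X" by (simp add: abs_mult)
      then have "\<bar>z\<bar> \<le> X / real_of_int \<bar>a\<bar>" using t(2) by (simp add: field_simps)
      then show ?thesis unfolding J_def z_def by (simp only: mem_Collect_eq) linarith
    qed
    ultimately show "t \<in> (SIGMA a:A. SIGMA b:{-\<bar>a\<bar>..\<bar>a\<bar>}. J a b)"
      using t by (auto simp: A_def)
  qed
  have fin: "finite (SIGMA a:A. SIGMA b:{-\<bar>a\<bar>..\<bar>a\<bar>}. J a b)" using finA J(1) by blast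
  then show "finite S" using sub finite_subset by blast
  have inner: "real (card (SIGMA b:{-\<bar>a\<bar>..\<bar>a\<bar>}. J a b)) \<le> 9 * X" if "a \<in> A" for a
  proof -
    have a: "real_of_int \<bar>a\<bar> \<ge> 1" using that by (auto simp: A_def)
    have "real_of_int \<bar>a\<bar> \<le> \<epsilon> * sqrt X" using that n0 by (auto simp: A_def)
    also have "\<epsilon> \<le> sqrt X" using \<epsilon>(2) sX(1) by linarith
    then have "\<epsilon> * sqrt X \<le> sqrt X * sqrt X" using sX(1) by (intro mult_right_mono) auto
    finally have aX: "real_of_int \<bar>a\<bar> \<le> X" by (simp only: sX(2))
    have "real (card (SIGMA b:{-\<bar>a\<bar>..\<bar>a\<bar>}. J a b)) = (\<Sum>b\<in>{-\<bar>a\<bar>..\<bar>a\<bar>}. real (card (J a b)))"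
      using J(1) by (subst card_SigmaI) auto
    also have "\<dots> \<le> (\<Sum>b\<in>{-\<bar>a\<bar>..\<bar>a\<bar>}. 2 * X / real_of_int \<bar>a\<bar> + 1)"
      by (intro sum_mono J(2))
    also have "\<dots> = (2 * real_of_int \<bar>a\<bar> + 1) * (2 * X / real_of_int \<bar>a\<bar> + 1)" by simp
    also have "\<dots> \<le> (3 * real_of_int \<bar>a\<bar>) * (3 * X / real_of_int \<bar>a\<bar>)"
    proof (intro mult_mono)
      have "1 \<le> X / real_of_int \<bar>a\<bar>" using a aX by (simp add: le_divide_eq)
      moreover have "3 * X / real_of_int \<bar>a\<bar> = 2 * X / real_of_int \<bar>a\<bar> + X / real_of_int \<bar>a\<bar>"
        by (simp add: add_divide_distrib[symmetric])
      ultimately show "2 * X / real_of_int \<bar>a\<bar> + 1 \<le> 3 * X / real_of_int \<bar>a\<bar>" by linarith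
    qed (use a X in auto)
    also have "\<dots> = 9 * X" using a by simp
    finally show ?thesis .
  qed
  have "card S \<le> card (SIGMA a:A. SIGMA b:{-\<bar>a\<bar>..\<bar>a\<bar>}. J a b)"
    by (rule card_mono[OF fin sub])
  also have "\<dots> = (\<Sum>a\<in>A. card (SIGMA b:{-\<bar>a\<bar>..\<bar>a\<bar>}. J a b))"
    using finA J(1) by (intro card_SigmaI) auto
  finally have "real (card S) \<le> (\<Sum>a\<in>A. real (card (SIGMA b:{-\<bar>a\<bar>..\<bar>a\<bar>}. J a b)))"
    by (metis of_nat_le_iff of_nat_sum)
  also have "\<dots> \<le> (\<Sum>a\<in>A. 9 * X)" by (intro sum_mono inner)
  also have "\<dots> = 2 * real_of_int n * (9 * X)" by (simp add: cardA)
  also have "\<dots> \<le> 2 * (\<epsilon> * sqrt X) * (9 * X)" using n0 X by (intro mult_right_mono) auto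
  also have "\<dots> = 18 * \<epsilon> * (sqrt X) ^ 3"
    using X by (simp add: power3_eq_cube)
  finally show "real (card S) \<le> 18 * \<epsilon> * (sqrt X) ^ 3" .
qed

lemma sum_inverse_squares_tail:
  assumes "G \<ge> (2::int)"
  shows "(\<Sum>g=G..Y. 1 / real_of_int g ^ 2) \<le> 1 / (real_of_int G - 1)"
proof (cases "Y \<ge> G - 1")
  case True
  then have "(\<Sum>g=G..Y. 1 / real_of_int g ^ 2) \<le> 1 / (real_of_int G - 1) - 1 / real_of_int Y"
  proof (induction Y rule: int_ge_induct)
    case base
    then show ?case by simp
  next
    case (step Y)
    have "{G..Y + 1} = insert (Y + 1) {G..Y}" using step.hyps by auto
    then have "(\<Sum>g=G..Y + 1. 1 / real_of_int g ^ 2) =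
        1 / real_of_int (Y + 1) ^ 2 + (\<Sum>g=G..Y. 1 / real_of_int g ^ 2)" by simp
    moreover have "1 / real_of_int (Y + 1) ^ 2 \<le> 1 / real_of_int Y - 1 / real_of_int (Y + 1)"
    proof -
      have Y: "real_of_int Y \<ge> 1" using step.hyps assms by simp
      have "1 / real_of_int (Y + 1) ^ 2 \<le> 1 / (real_of_int Y * real_of_int (Y + 1))"
        using Y unfolding power2_eq_square by (intro divide_left_mono mult_right_mono) auto
      also have "\<dots> = 1 / real_of_int Y - 1 / real_of_int (Y + 1)" using Y by (simp add: field_simps)
      finally show ?thesis .
    qed
    ultimately show ?case using step.IH by linarith
  qed
  moreover have "real_of_int Y \<ge> 1" using True assms by simp
  ultimately show ?thesis by (smt (verit) divide_nonneg_nonneg)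
qed (use assms in simp)

text \<open>Because zero coefficients are excluded, an interval [-Y, Y] holds at most
  \<open>2 * Y / g\<close> admissible multiples of g, with no additive constant. Hence
  \<open>8 * Y^3 / g^3\<close> forms for each g.\<close>

lemma card_large_content:
  assumes G: "G \<ge> (2::int)" and Y: "Y \<ge> 0"
  defines "S \<equiv> {(a, b, c). a \<noteq> 0 \<and> b \<noteq> 0 \<and> c \<noteq> 0 \<and> \<bar>a\<bar> \<le> Y \<and> \<bar>b\<bar> \<le> Y \<and> \<bar>c\<bar> \<le> Y \<and>
    G \<le> bqf_content (a, b, c)}"
  shows "finite S" "real (card S) \<le> 8 * real_of_int Y ^ 3 / (real_of_int G - 1)"
proof -
  define I where "I g = {- (Y div g)..Y div g} - {0}" for g
  define T where "T g = (\<lambda>(x, y, z). (g * x, g * y, g * z)) ` (I g \<times> I g \<times> I g)" for g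
  have finI: "finite (I g)" for g by (simp add: I_def)
  have finT: "finite (T g)" for g using finI by (simp add: T_def)
  have sub: "S \<subseteq> (\<Union>g\<in>{G..Y}. T g)"
  proof
    fix t assume "t \<in> S"
    then obtain a b c where t: "t = (a, b, c)" "a \<noteq> 0" "b \<noteq> 0" "c \<noteq> 0" "\<bar>a\<bar> \<le> Y" "\<bar>b\<bar> \<le> Y" "\<bar>c\<bar> \<le> Y"
      "G \<le> bqf_content (a, b, c)" by (auto simp: S_def)
    define g where "g = bqf_content (a, b, c)"
    have g: "g > 0" "g dvd a" "g dvd b" "g dvd c" "G \<le> g"
      using t(8) G dvd_bqf_content_iff[of g a b c] by (auto simp: g_def)
    have "g \<le> Y" using zdvd_imp_le[of g "\<bar>a\<bar>"] g t by simp
    have *: "\<exists>y\<in>I g. x = g * y" if "g dvd x" "x \<noteq> 0" "\<bar>x\<bar> \<le> Y" for x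
    proof -
      from that obtain y where y: "x = g * y" by blast
      then have "g * \<bar>y\<bar> \<le> Y" using that(3) g(1) by (simp add: abs_mult)
      then have "\<bar>y\<bar> \<le> Y div g" using g(1) by (metis nonzero_mult_div_cancel_left zdiv_mono1 less_irrefl)
      then show ?thesis using y that(2) by (auto simp: I_def intro!: bexI[of _ y])
    qed
    obtain x y z where "x \<in> I g" "y \<in> I g" "z \<in> I g" "a = g * x" "b = g * y" "c = g * z"
      using *[of a] *[of b] *[of c] t g by blast
    then have "t \<in> T g" unfolding T_def t(1) by (intro image_eqI[of _ _ "(x, y, z)"]) auto
    then show "t \<in> (\<Union>g\<in>{G..Y}. T g)" using g(5) \<open>g \<le> Y\<close> by auto
  qed
  have fin: "finite (\<Union>g\<in>{G..Y}. T g)" using finT by simp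
  show "finite S" by (rule finite_subset[OF sub fin])
  have cT: "real (card (T g)) \<le> 8 * real_of_int Y ^ 3 * (1 / real_of_int g ^ 2)" if "g \<in> {G..Y}" for g
  proof -
    have g: "g \<ge> 1" using that G by simp
    have "card (T g) \<le> card (I g \<times> I g \<times> I g)"
      unfolding T_def using finI by (intro card_image_le) simp
    also have "\<dots> = card (I g) ^ 3" by (simp add: card_cartesian_product power3_eq_cube)
    finally have "real (card (T g)) \<le> real (card (I g)) ^ 3" by (metis of_nat_le_iff of_nat_power)
    also have "\<dots> \<le> (2 * (real_of_int Y / real_of_int g)) ^ 3"
    proof (rule power_mono)
      have "Y div g \<ge> 0" using Y g by (simp add: pos_imp_zdiv_nonneg_iff)
      then have "real (card (I g)) = 2 * real_of_int (Y div g)"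
        by (simp add: I_def card_Diff_subset)
      also have "\<dots> \<le> 2 * (real_of_int Y / real_of_int g)" using real_of_int_div4[of Y g] by simp
      finally show "real (card (I g)) \<le> 2 * (real_of_int Y / real_of_int g)" .
    qed simp
    also have "\<dots> = 8 * real_of_int Y ^ 3 * (1 / real_of_int g ^ 3)"
      by (simp add: power_mult_distrib power_divide)
    \<comment> \<open>Weakened to the exponent 2, for which the tail telescopes.\<close>
    also have "\<dots> \<le> 8 * real_of_int Y ^ 3 * (1 / real_of_int g ^ 2)"
      using g Y by (intro mult_left_mono divide_left_mono power_increasing) auto
    finally show ?thesis .
  qed
  have "card S \<le> card (\<Union>g\<in>{G..Y}. T g)" by (rule card_mono[OF fin sub])
  also have "\<dots> \<le> (\<Sum>g\<in>{G..Y}. card (T g))" by (rule card_UN_le) simp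
  finally have "real (card S) \<le> (\<Sum>g\<in>{G..Y}. real (card (T g)))" by (metis of_nat_le_iff of_nat_sum)
  also have "\<dots> \<le> (\<Sum>g\<in>{G..Y}. 8 * real_of_int Y ^ 3 * (1 / real_of_int g ^ 2))"
    by (intro sum_mono cT)
  also have "\<dots> = 8 * real_of_int Y ^ 3 * (\<Sum>g=G..Y. 1 / real_of_int g ^ 2)"
    by (simp add: sum_distrib_left)
  also have "\<dots> \<le> 8 * real_of_int Y ^ 3 * (1 / (real_of_int G - 1))"
    using Y by (intro mult_left_mono sum_inverse_squares_tail G) auto
  finally show "real (card S) \<le> 8 * real_of_int Y ^ 3 / (real_of_int G - 1)" by simp
qed

lemma card_weighted_le:
  fixes S :: "'a \<Rightarrow> 'b set"
  assumes "finite B" "\<And>f. f \<in> E \<Longrightarrow> S f \<subseteq> B" "\<And>f. f \<in> E \<Longrightarrow> card (S f) = K"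
    and disj: "\<And>f g. f \<in> E \<Longrightarrow> g \<in> E \<Longrightarrow> f \<noteq> g \<Longrightarrow> S f \<inter> S g = {}" and "finite E"
  shows "K * card E \<le> card B"
proof -
  have fin: "finite (S f)" if "f \<in> E" for f using assms(1,2) that finite_subset by blast
  have "card (\<Union>f\<in>E. S f) = (\<Sum>f\<in>E. card (S f))"
    by (rule card_UN_disjoint) (use assms fin in blast)+
  also have "\<dots> = K * card E" using assms(3) by simp
  finally have "K * card E = card (\<Union>f\<in>E. S f)" by simp
  also have "\<dots> \<le> card B" by (rule card_mono) (use assms in blast)+
  finally show ?thesis .
qed

section \<open>Minimal representatives of the classes\<close>

text \<open>The minimality ranges over all integral forms equivalent over \<open>Z_inv m\<close>; it
  is this, not reducedness, that later bounds the other members of the class from below.\<close>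

definition minimal_rep :: "int \<Rightarrow> int bqf \<Rightarrow> bool" where
  "minimal_rep m = (\<lambda>(a, b, c). bqf_disc (a, b, c) = 1 - 4 * m \<and>
     (\<forall>a' b' c'. zequiv m (a, b, c) (a', b', c') \<longrightarrow> \<bar>a\<bar> \<le> \<bar>a'\<bar>) \<and>
     (a = 0 \<and> 0 \<le> c \<and> c < \<bar>b\<bar> \<or> is_reduced (a, b, c)))"

definition reps :: "int \<Rightarrow> int bqf set" where
  "reps m = (\<lambda>C. SOME f. rat_bqf f \<in> C \<and> minimal_rep m f) ` SL2_classes (Z_inv m) (of_int (1 - 4 * m))"

lemma class_has_minimal_rep:
  assumes m: "m \<noteq> 0" and C: "C \<in> SL2_classes (Z_inv m) (of_int (1 - 4 * m))"
  shows "\<exists>f. rat_bqf f \<in> C \<and> minimal_rep m f"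
proof -
  let ?E = "SL2_equiv (Z_inv m) (of_int (1 - 4 * m))"
  have tr: "\<And>f g h. (f, g) \<in> ?E \<Longrightarrow> (g, h) \<in> ?E \<Longrightarrow> (f, h) \<in> ?E"
    using equiv_Z_inv[OF m] unfolding equiv_def by (blast dest: transD)
  from C obtain f where f: "f \<in> bqf_of_disc (Z_inv m) (of_int (1 - 4 * m))" "C = ?E `` {f}"
    unfolding SL2_classes_def by (rule quotientE)
  from SL2_equiv_integral[OF m f(1)] obtain g where g: "(f, rat_bqf g) \<in> ?E" by blast
  then have "rat_bqf g \<in> bqf_of_disc (Z_inv m) (of_int (1 - 4 * m))" by (auto simp: SL2_equiv_def)
  then have "bqf_disc g = 1 - 4 * m" using rat_bqf_in_iff[OF m] by blast
  from zequiv_minimal_form[OF m this] obtain a b c where h: "zequiv m g (a, b, c)"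
    "\<forall>a' b' c'. zequiv m g (a', b', c') \<longrightarrow> \<bar>a\<bar> \<le> \<bar>a'\<bar>"
    "a = 0 \<and> 0 \<le> c \<and> c < \<bar>b\<bar> \<or> a \<noteq> 0 \<and> \<bar>b\<bar> \<le> \<bar>a\<bar> \<and> \<bar>a\<bar> \<le> \<bar>c\<bar>" by blast
  have "rat_bqf (a, b, c) \<in> C" using tr[OF g h(1)[unfolded zequiv_def]] by (simp add: f(2))
  moreover have "minimal_rep m (a, b, c)"
    unfolding minimal_rep_def prod.case is_reduced_def
    using h zequiv_disc(2)[OF m h(1)] zequiv_trans[OF m h(1)] by blast
  ultimately show ?thesis by blast
qed

lemma reps_choice:
  assumes m: "m \<noteq> 0" and C: "C \<in> SL2_classes (Z_inv m) (of_int (1 - 4 * m))"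
  defines "f \<equiv> SOME f. rat_bqf f \<in> C \<and> minimal_rep m f"
  shows "rat_bqf f \<in> C" "minimal_rep m f"
  using someI_ex[OF class_has_minimal_rep[OF m C]] unfolding f_def by blast+

lemma minimal_rep_reps: "m \<noteq> 0 \<Longrightarrow> f \<in> reps m \<Longrightarrow> minimal_rep m f"
  unfolding reps_def using reps_choice(2) by blast

lemma reps_zequiv_imp_eq:
  assumes m: "m \<noteq> 0" and fg: "f \<in> reps m" "g \<in> reps m" and z: "zequiv m f g"
  shows "f = g"
proof -
  from fg obtain C D where C: "C \<in> SL2_classes (Z_inv m) (of_int (1 - 4 * m))"
      "f = (SOME f. rat_bqf f \<in> C \<and> minimal_rep m f)"
    and D: "D \<in> SL2_classes (Z_inv m) (of_int (1 - 4 * m))"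
      "g = (SOME f. rat_bqf f \<in> D \<and> minimal_rep m f)" unfolding reps_def by blast
  have "rat_bqf f \<in> C" "rat_bqf g \<in> D" using reps_choice(1)[OF m] C D by blast+
  then have "C = D"
    using quotient_eqI[OF equiv_Z_inv[OF m] C(1)[unfolded SL2_classes_def] D(1)[unfolded SL2_classes_def]] z
    unfolding zequiv_def by blast
  then show ?thesis using C(2) D(2) by simp
qed

lemma inj_on_reps:
  assumes m: "m \<noteq> 0"
  shows "inj_on (\<lambda>C. SOME f. rat_bqf f \<in> C \<and> minimal_rep m f) (SL2_classes (Z_inv m) (of_int (1 - 4 * m)))"
proof (rule inj_onI)
  fix C D assume C: "C \<in> SL2_classes (Z_inv m) (of_int (1 - 4 * m))"
    and D: "D \<in> SL2_classes (Z_inv m) (of_int (1 - 4 * m))"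
    and eq: "(SOME f. rat_bqf f \<in> C \<and> minimal_rep m f) = (SOME f. rat_bqf f \<in> D \<and> minimal_rep m f)"
  have "C \<inter> D \<noteq> {}" using reps_choice(1)[OF m C] reps_choice(1)[OF m D] eq by auto
  then show "C = D"
    using quotient_disj[OF equiv_Z_inv[OF m] C[unfolded SL2_classes_def] D[unfolded SL2_classes_def]] by blast
qed

lemma minimal_rep_bounds:
  assumes "minimal_rep m (a, b, c)"
  shows "bqf_disc (a, b, c) = 1 - 4 * m"
    and "a \<noteq> 0 \<Longrightarrow> is_reduced (a, b, c)"
    and "a = 0 \<Longrightarrow> 0 \<le> c \<and> c < \<bar>b\<bar>"
    and "zequiv m (a, b, c) (a', b', c') \<Longrightarrow> \<bar>a\<bar> \<le> \<bar>a'\<bar>"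
  using assms unfolding minimal_rep_def is_reduced_def by auto

lemma is_reduced_bounds:
  assumes "is_reduced (a, b, c)"
  shows "3 * (\<bar>a\<bar> * \<bar>c\<bar>) \<le> \<bar>bqf_disc (a, b, c)\<bar>" "3 * a\<^sup>2 \<le> \<bar>bqf_disc (a, b, c)\<bar>" "b\<^sup>2 \<le> a\<^sup>2"
    "c \<noteq> 0"
  using reduced_bounds[of b a c] assms unfolding is_reduced_def by (auto simp: abs_le_square_iff)

text \<open>Reduced forms of a given discriminant are bounded, and so are the representatives with
  \<open>a = 0\<close>. Finiteness of the set of classes follows from this.\<close>

lemma finite_reps:
  assumes m: "m \<noteq> 0"
  shows "finite (reps m)"
proof (rule finite_subset)
  let ?D = "\<bar>1 - 4 * m\<bar>"
  show "reps m \<subseteq> {-?D..?D} \<times> {-?D..?D} \<times> {-?D..?D}"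
  proof
    fix f assume "f \<in> reps m"
    then have f: "minimal_rep m f" by (rule minimal_rep_reps[OF m])
    obtain a b c where abc: "f = (a, b, c)" by (cases f)
    note bounds = minimal_rep_bounds[OF f[unfolded abc]]
    have sq: "\<bar>x\<bar> \<le> x\<^sup>2" for x :: int
      using mult_left_mono[of 1 "\<bar>x\<bar>" "\<bar>x\<bar>"]
      by (cases "x = 0") (simp_all add: power2_eq_square)
    have "\<bar>a\<bar> \<le> ?D \<and> \<bar>b\<bar> \<le> ?D \<and> \<bar>c\<bar> \<le> ?D"
    proof (cases "a = 0")
      case True
      then have "b\<^sup>2 = 1 - 4 * m" using bounds(1) by (simp add: bqf_disc_def)
      then show ?thesis using True bounds(3) sq[of b] by simp
    next
      case False
      note red = bounds(2)[OF False]
      have "\<bar>c\<bar> \<le> \<bar>a\<bar> * \<bar>c\<bar>" using False mult_right_mono[of 1 "\<bar>a\<bar>" "\<bar>c\<bar>"] by simp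
      moreover have "0 \<le> \<bar>a\<bar> * \<bar>c\<bar>" by simp
      moreover have "\<bar>b\<bar> \<le> \<bar>a\<bar>" "\<bar>a\<bar> \<le> \<bar>c\<bar>" using red by (simp_all add: is_reduced_def)
      moreover have "3 * (\<bar>a\<bar> * \<bar>c\<bar>) \<le> ?D" using is_reduced_bounds(1)[OF red] by (simp only: bounds(1))
      ultimately show ?thesis by linarith
    qed
    then show "f \<in> {-?D..?D} \<times> {-?D..?D} \<times> {-?D..?D}" by (auto simp: abc)
  qed
qed simp

lemma finite_classes:
  assumes "m \<noteq> 0"
  shows "finite (SL2_classes (Z_inv m) (of_int (1 - 4 * m)))"
  using finite_reps[OF assms] finite_image_iff[OF inj_on_reps[OF assms]] by (simp add: reps_def)

lemma card_reps:
  assumes "m \<noteq> 0"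
  shows "card (reps m) = card (SL2_classes (Z_inv m) (of_int (1 - 4 * m)))"
  unfolding reps_def by (rule card_image[OF inj_on_reps[OF assms]])

definition all_reps :: "real \<Rightarrow> int bqf set" where
  "all_reps X = (\<Union>m\<in>{m. m \<noteq> 0 \<and> real_of_int m \<in> {-X..X}}. reps m)"

lemma finite_parameters: "finite {m. m \<noteq> 0 \<and> real_of_int m \<in> {-X..X}}"
proof (rule finite_subset)
  show "{m. m \<noteq> 0 \<and> real_of_int m \<in> {-X..X}} \<subseteq> {\<lceil>-X\<rceil>..\<lfloor>X\<rfloor>}"
    by (auto simp: ceiling_le_iff le_floor_iff)
qed simp

lemma reps_disc: "m \<noteq> 0 \<Longrightarrow> f \<in> reps m \<Longrightarrow> bqf_disc f = 1 - 4 * m"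
  using minimal_rep_reps[of m f] minimal_rep_bounds(1)[of m] by (cases f) simp

lemma class_total_eq_card: "class_total X = card (all_reps X)"
proof -
  have "card (all_reps X) = (\<Sum>m | m \<noteq> 0 \<and> real_of_int m \<in> {-X..X}. card (reps m))"
    unfolding all_reps_def
  proof (rule card_UN_disjoint[OF finite_parameters])
    show "\<forall>m\<in>{m. m \<noteq> 0 \<and> real_of_int m \<in> {-X..X}}. \<forall>n\<in>{m. m \<noteq> 0 \<and> real_of_int m \<in> {-X..X}}.
        m \<noteq> n \<longrightarrow> reps m \<inter> reps n = {}"
    proof (intro ballI impI)
      fix m n assume mn: "m \<in> {m. m \<noteq> 0 \<and> real_of_int m \<in> {-X..X}}"
        "n \<in> {m. m \<noteq> 0 \<and> real_of_int m \<in> {-X..X}}" "m \<noteq> n"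
      show "reps m \<inter> reps n = {}"
      proof (rule ccontr)
        assume "reps m \<inter> reps n \<noteq> {}"
        then obtain f where "f \<in> reps m" "f \<in> reps n" by blast
        then have "1 - 4 * m = 1 - 4 * n" using reps_disc[of m f] reps_disc[of n f] mn(1,2) by simp
        then show False using mn(3) by simp
      qed
    qed
    show "\<forall>m\<in>{m. m \<noteq> 0 \<and> real_of_int m \<in> {-X..X}}. finite (reps m)"
      using finite_reps by simp
  qed
  also have "\<dots> = class_total X"
    unfolding class_total_def by (rule sum.cong) (auto simp: card_reps)
  finally show ?thesis by simp
qed

lemma finite_all_reps: "finite (all_reps X)"
  unfolding all_reps_def by (rule finite_UN_I[OF finite_parameters]) (simp add: finite_reps)

text \<open>The sets S attached to different representatives are disjoint: a common form determines
  m by its discriminant, and then the class. All of them share one cube.\<close>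

lemma card_reps_many:
  assumes E: "finite E"
    and many: "\<And>f. f \<in> E \<Longrightarrow> \<exists>m S. m \<noteq> 0 \<and> f \<in> reps m \<and> card S = K \<and>
      (\<forall>g\<in>S. zequiv m f g \<and> g \<in> {-Y..Y} \<times> {-Y..Y} \<times> {-Y..Y})"
  shows "K * card E \<le> nat (2 * Y + 1) ^ 3"
proof -
  have "\<forall>f\<in>E. \<exists>p. fst p \<noteq> 0 \<and> f \<in> reps (fst p) \<and> card (snd p) = K \<and>
      (\<forall>g\<in>snd p. zequiv (fst p) f g \<and> g \<in> {-Y..Y} \<times> {-Y..Y} \<times> {-Y..Y})"
  proof
    fix f assume "f \<in> E"
    from many[OF this] obtain m S where "m \<noteq> 0 \<and> f \<in> reps m \<and> card S = K \<and>
      (\<forall>g\<in>S. zequiv m f g \<and> g \<in> {-Y..Y} \<times> {-Y..Y} \<times> {-Y..Y})" by (elim exE)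
    then show "\<exists>p. fst p \<noteq> 0 \<and> f \<in> reps (fst p) \<and> card (snd p) = K \<and>
      (\<forall>g\<in>snd p. zequiv (fst p) f g \<and> g \<in> {-Y..Y} \<times> {-Y..Y} \<times> {-Y..Y})"
      by (intro exI[of _ "(m, S)"]) (unfold fst_conv snd_conv)
  qed
  from bchoice[OF this] obtain p where p: "\<forall>f\<in>E. fst (p f) \<noteq> 0 \<and> f \<in> reps (fst (p f)) \<and>
      card (snd (p f)) = K \<and>
      (\<forall>g\<in>snd (p f). zequiv (fst (p f)) f g \<and> g \<in> {-Y..Y} \<times> {-Y..Y} \<times> {-Y..Y})" ..
  define \<mu> S where "\<mu> f = fst (p f)" and "S f = snd (p f)" for f
  have S: "\<mu> f \<noteq> 0 \<and> f \<in> reps (\<mu> f) \<and> card (S f) = K \<and>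
      (\<forall>g\<in>S f. zequiv (\<mu> f) f g \<and> g \<in> {-Y..Y} \<times> {-Y..Y} \<times> {-Y..Y})" if "f \<in> E" for f
    using bspec[OF p that] unfolding \<mu>_def S_def .
  have "K * card E \<le> card ({-Y..Y} \<times> {-Y..Y} \<times> {-Y..Y})"
  proof (rule card_weighted_le)
    show "S f \<inter> S g = {}" if fg: "f \<in> E" "g \<in> E" "f \<noteq> g" for f g
    proof (rule ccontr)
      assume "S f \<inter> S g \<noteq> {}"
      then obtain h where h: "zequiv (\<mu> f) f h" "zequiv (\<mu> g) g h"
        using S[OF fg(1)] S[OF fg(2)] by blast
      have m: "\<mu> f \<noteq> 0" "\<mu> g \<noteq> 0" using S[OF fg(1)] S[OF fg(2)] by blast+
      have "1 - 4 * \<mu> f = 1 - 4 * \<mu> g"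
        using zequiv_disc(2)[OF m(1) h(1)] zequiv_disc(2)[OF m(2) h(2)] by simp
      then have eq: "\<mu> g = \<mu> f" by simp
      have "zequiv (\<mu> f) f g"
        using zequiv_trans[OF m(1) h(1)] zequiv_sym[OF m(2) h(2)] unfolding eq by blast
      then have "f = g" using reps_zequiv_imp_eq[OF m(1)] S[OF fg(1)] S[OF fg(2)] unfolding eq by blast
      with fg show False by simp
    qed
    show "S f \<subseteq> {-Y..Y} \<times> {-Y..Y} \<times> {-Y..Y}" if "f \<in> E" for f
      using S[OF that] by blast
    show "card (S f) = K" if "f \<in> E" for f
      using S[OF that] by blast
  qed (simp_all add: E)
  also have "card ({-Y..Y} \<times> {-Y..Y} \<times> {-Y..Y}) = nat (2 * Y + 1) ^ 3"
    by (simp add: card_cartesian_product power3_eq_cube algebra_simps)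
  finally show ?thesis .
qed

text \<open>Each outer coefficient exceeds \<open>\<epsilon> * sqrt X\<close> and their product is
  at most \<open>5 / 3 * X\<close>, so each is below \<open>2 / \<epsilon> * sqrt X\<close>. The
  middle one is at most \<open>3 * sqrt X\<close>; the side of the cube adds the two bounds.\<close>

lemma box_mem:
  assumes X: "X \<ge> 1" and \<epsilon>: "\<epsilon> > 0" and a: "\<epsilon> * sqrt X < real_of_int \<bar>a\<bar>" and c: "\<epsilon> * sqrt X < real_of_int \<bar>c\<bar>"
    and ac: "real_of_int (3 * (\<bar>a\<bar> * \<bar>c\<bar>)) \<le> 5 * X" and b: "real_of_int (b\<^sup>2) \<le> 5 * X"
    and Y: "Y = \<lfloor>(3 + 2 / \<epsilon>) * sqrt X\<rfloor>"
  shows "(a, b, c) \<in> {-Y..Y} \<times> {-Y..Y} \<times> {-Y..Y}"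
proof -
  define s where "s = sqrt X"
  have s: "s \<ge> 1" "s * s = X" using X by (simp_all add: s_def)
  have le: "x \<in> {-Y..Y}" if "real_of_int \<bar>x\<bar> \<le> (3 + 2 / \<epsilon>) * s" for x
  proof -
    have "\<bar>x\<bar> \<le> Y" unfolding Y le_floor_iff using that by (simp add: s_def)
    then show ?thesis by auto
  qed
  have prod: "real_of_int \<bar>x\<bar> \<le> (3 + 2 / \<epsilon>) * s"
    if "\<epsilon> * s < real_of_int \<bar>y\<bar>" "3 * (real_of_int \<bar>x\<bar> * real_of_int \<bar>y\<bar>) \<le> 5 * X" for x y
  proof -
    have "3 * (real_of_int \<bar>x\<bar> * (\<epsilon> * s)) \<le> 3 * (real_of_int \<bar>x\<bar> * real_of_int \<bar>y\<bar>)"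
      using that(1) by (intro mult_left_mono) auto
    also have "\<dots> \<le> 5 * (s * s)" using that(2) s by simp
    finally have "(3 * real_of_int \<bar>x\<bar> * \<epsilon>) * s \<le> (5 * s) * s" by (simp add: algebra_simps)
    then have "3 * real_of_int \<bar>x\<bar> * \<epsilon> \<le> 5 * s" using s by (simp add: mult_le_cancel_right)
    then have "real_of_int \<bar>x\<bar> \<le> 5 / 3 * s / \<epsilon>" using \<epsilon> by (simp add: field_simps)
    also have "\<dots> \<le> 2 * s / \<epsilon>" using \<epsilon> s by (intro divide_right_mono) auto
    also have "\<dots> \<le> (3 + 2 / \<epsilon>) * s" using \<epsilon> s by (simp add: algebra_simps)
    finally show ?thesis .
  qed
  have "\<bar>real_of_int b\<bar> \<le> 3 * s"
  proof (rule power2_le_imp_le)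
    have "(real_of_int b)\<^sup>2 \<le> 9 * (s * s)" using b s X by simp
    then show "\<bar>real_of_int b\<bar>\<^sup>2 \<le> (3 * s)\<^sup>2" by (simp add: power2_eq_square)
  qed (use s in simp)
  also have "\<dots> \<le> (3 + 2 / \<epsilon>) * s" using \<epsilon> s by (simp add: algebra_simps)
  finally have "real_of_int \<bar>b\<bar> \<le> (3 + 2 / \<epsilon>) * s" by simp
  moreover have "real_of_int \<bar>a\<bar> \<le> (3 + 2 / \<epsilon>) * s"
    by (rule prod[of c]) (use c ac in \<open>simp_all add: s_def\<close>)
  moreover have "real_of_int \<bar>c\<bar> \<le> (3 + 2 / \<epsilon>) * s"
    by (rule prod[of a]) (use a ac in \<open>simp_all add: s_def mult.commute\<close>)
  ultimately show ?thesis using le by blast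
qed

section \<open>The total number of classes\<close>

text \<open>\<open>h1\<close> excludes coincidences along the river and \<open>h2\<close> those
  among the reductions obtained from a prime. Both hold once X is large in terms of the other
  parameters.\<close>

lemma reps_many:
  assumes m: "m \<noteq> 0" "\<bar>real_of_int m\<bar> \<le> X" and X: "X \<ge> 1" and \<epsilon>: "\<epsilon> > 0"
    and Y: "Y = \<lfloor>(3 + 2 / \<epsilon>) * sqrt X\<rfloor>"
    and f: "(a, b, c) \<in> reps m" "\<epsilon> * sqrt X < real_of_int \<bar>a\<bar>" "bqf_content (a, b, c) < G"
    and p: "m > 0 \<Longrightarrow> \<exists>p. prime p \<and> p \<le> P \<and> int p dvd m"
    and h1: "2 ^ K * real_of_int G \<le> \<epsilon> * sqrt X"
    and h2: "4 * real P ^ (2 * K) * real_of_int G ^ 2 \<le> 3 * \<epsilon>\<^sup>2 * X"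
  shows "\<exists>S. card S = K \<and> (\<forall>g\<in>S. zequiv m (a, b, c) g \<and> g \<in> {-Y..Y} \<times> {-Y..Y} \<times> {-Y..Y})"
proof -
  note min = minimal_rep_bounds[OF minimal_rep_reps[OF m(1) f(1)]]
  define D where "D = 1 - 4 * m"
  have D5: "real_of_int \<bar>D\<bar> \<le> 5 * X" using m X by (simp add: D_def)
  have "\<epsilon> * sqrt X > 0" using \<epsilon> X by simp
  then have a0: "a \<noteq> 0" using f(2) by auto
  note red = min(2)[OF a0]
  have lead: "\<epsilon> * sqrt X < real_of_int \<bar>a'\<bar>" if "zequiv m (a, b, c) (a', b', c')" for a' b' c'
    using f(2) min(4)[OF that] by linarith
  have last: "\<epsilon> * sqrt X < real_of_int \<bar>c'\<bar>" if "zequiv m (a, b, c) (a', b', c')" for a' b' c'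
    using lead[OF zequiv_swap[OF m(1) that]] .
  have disc: "bqf_disc (a', b', c') = D" if "zequiv m (a, b, c) (a', b', c')" for a' b' c'
    using zequiv_disc(2)[OF m(1) that] by (simp add: D_def)
  show ?thesis
  proof (cases "m > 0")
    case True
    from p[OF this] obtain q where q: "prime q" "q \<le> P" "int q dvd m" by blast
    \<comment> \<open>Reducedness turns the lower bound for a into one for the discriminant:
      \<open>4 * m - 1 \<ge> 3 * a^2 > 3 * \<epsilon>^2 * X\<close>.\<close>
    have big: "4 * int q ^ (2 * K) * (bqf_content (a, b, c))\<^sup>2 < 4 * m - 1"
    proof -
      have "real_of_int (4 * int q ^ (2 * K) * (bqf_content (a, b, c))\<^sup>2) =
          4 * real q ^ (2 * K) * (real_of_int (bqf_content (a, b, c)))\<^sup>2" by simp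
      also have "\<dots> \<le> 4 * real P ^ (2 * K) * (real_of_int G)\<^sup>2"
        using q(2) f(3) bqf_content_nonneg[of "(a, b, c)"]
        by (intro mult_mono power_mono) auto
      also have "\<dots> \<le> 3 * (\<epsilon> * sqrt X)\<^sup>2" using h2 X by (simp add: power_mult_distrib)
      also have "\<dots> < 3 * (real_of_int \<bar>a\<bar>)\<^sup>2"
        using f(2) \<open>\<epsilon> * sqrt X > 0\<close> by (intro mult_strict_left_mono power_strict_mono) auto
      also have "\<dots> = real_of_int (3 * a\<^sup>2)" by simp
      also have "\<dots> \<le> real_of_int \<bar>bqf_disc (a, b, c)\<bar>"
        using is_reduced_bounds(2)[OF red] by (simp only: of_int_le_iff)
      also have "\<bar>bqf_disc (a, b, c)\<bar> = 4 * m - 1" using min(1) True by simp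
      finally show ?thesis by (simp only: of_int_less_iff)
    qed
    have "prime (int q)" using q(1) by simp
    from definite_many[OF True min(1) this q(3) big] obtain S where S: "card S = K"
      "\<forall>g\<in>S. zequiv m (a, b, c) g \<and> is_reduced g" by (elim exE conjE)
    have "g \<in> {-Y..Y} \<times> {-Y..Y} \<times> {-Y..Y}" if "g \<in> S" for g
    proof -
      obtain a' b' c' where g: "g = (a', b', c')" by (cases g)
      have z: "zequiv m (a, b, c) (a', b', c')" "is_reduced (a', b', c')"
        using bspec[OF S(2) that] unfolding g by blast+
      note rb = is_reduced_bounds[OF z(2), unfolded disc[OF z(1)]]
      show ?thesis unfolding g
      proof (rule box_mem[OF X \<epsilon> lead[OF z(1)] last[OF z(1)] _ _ Y])
        show "real_of_int (3 * (\<bar>a'\<bar> * \<bar>c'\<bar>)) \<le> 5 * X"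
          using D5 of_int_le_iff[where 'a = real, THEN iffD2, OF rb(1)] by linarith
        have "b'\<^sup>2 \<le> \<bar>D\<bar>" using rb(2,3) zero_le_power2[of a'] by linarith
        from of_int_le_iff[where 'a = real, THEN iffD2, OF this]
        show "real_of_int (b'\<^sup>2) \<le> 5 * X" using D5 by linarith
      qed
    qed
    then show ?thesis using S by (intro exI[of _ S]) blast
  next
    case False
    have D0: "D > 0" using False m(1) by (simp add: D_def)
    \<comment> \<open>The representative itself lies on the river: as \<open>b^2\<close> is at most
      \<open>\<bar>a * c\<bar>\<close>, a positive discriminant forces
      \<open>a * c < 0\<close>.\<close>
    have "b\<^sup>2 - 4 * (a * c) = D" using min(1) by (simp add: bqf_disc_def D_def)
    moreover have "b\<^sup>2 \<le> \<bar>a * c\<bar>"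
    proof -
      have "\<bar>b\<bar> * \<bar>b\<bar> \<le> \<bar>a\<bar> * \<bar>c\<bar>"
        using red unfolding is_reduced_def by (intro mult_mono) auto
      then show ?thesis by (simp add: abs_mult power2_eq_square)
    qed
    ultimately have ac: "a * c < 0" using D0 by linarith
    have big: "2 ^ K * bqf_content (a, b, c) < \<bar>a'\<bar>" if "zequiv m (a, b, c) (a', b', c')" for a' b' c'
    proof -
      have "real_of_int (2 ^ K * bqf_content (a, b, c)) = 2 ^ K * real_of_int (bqf_content (a, b, c))" by simp
      also have "\<dots> \<le> 2 ^ K * real_of_int G" using f(3) by (intro mult_left_mono) auto
      also have "\<dots> \<le> \<epsilon> * sqrt X" by (rule h1)
      also have "\<dots> < real_of_int \<bar>a'\<bar>" by (rule lead[OF that])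
      finally show ?thesis by (simp only: of_int_less_iff)
    qed
    have "\<exists>S. finite S \<and> card S = K \<and>
        (\<forall>g\<in>S. zequiv m (a, b, c) g \<and> (case g of (a, b, c) \<Rightarrow> a * c < 0))"
      by (rule indefinite_many[OF m(1) zequiv_refl[OF m(1) min(1)] ac]) (rule big)
    then obtain S where S: "card S = K"
      "\<forall>g\<in>S. zequiv m (a, b, c) g \<and> (case g of (a, b, c) \<Rightarrow> a * c < 0)" by (elim exE conjE)
    have "g \<in> {-Y..Y} \<times> {-Y..Y} \<times> {-Y..Y}" if "g \<in> S" for g
    proof -
      obtain a' b' c' where g: "g = (a', b', c')" by (cases g)
      have z: "zequiv m (a, b, c) (a', b', c')" "a' * c' < 0"
        using bspec[OF S(2) that] unfolding g prod.case by blast+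
      \<comment> \<open>Forms on the river need not be reduced, but with opposite outer signs the
        discriminant is a sum of nonnegative terms, which bounds them as well.\<close>
      have eq: "b'\<^sup>2 + 4 * (\<bar>a'\<bar> * \<bar>c'\<bar>) = D"
        using disc[OF z(1)] z(2) by (simp add: bqf_disc_def flip: abs_mult)
      have le: "b'\<^sup>2 \<le> \<bar>D\<bar>" "3 * (\<bar>a'\<bar> * \<bar>c'\<bar>) \<le> \<bar>D\<bar>"
        using eq zero_le_power2[of b'] mult_nonneg_nonneg[OF abs_ge_zero abs_ge_zero, of a' c'] by linarith+
      show ?thesis unfolding g
        by (rule box_mem[OF X \<epsilon> lead[OF z(1)] last[OF z(1)] _ _ Y])
          (use D5 le[THEN of_int_le_iff[where 'a = real, THEN iffD2]] in linarith)+
    qed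
    then show ?thesis using S by (intro exI[of _ S]) blast
  qed
qed

text \<open>\<open>S0\<close> to \<open>S3\<close> collect the representatives with zero lead, small
  lead, large content, and positive m without a small prime factor. The rest form \<open>S4\<close>,
  whose classes have K forms each in the cube.\<close>

lemma class_total_le:
  assumes X: "X \<ge> 1" and \<epsilon>: "0 < \<epsilon>" "\<epsilon> \<le> 1" and Y: "Y = \<lfloor>(3 + 2 / \<epsilon>) * sqrt X\<rfloor>"
    and G: "G \<ge> 2" and K: "K > 0"
    and sieve: "real (card (unsieved {p. prime p \<and> p \<le> P} {-Y..Y})) \<le> \<delta> * real_of_int Y ^ 3"
    and h1: "2 ^ K * real_of_int G \<le> \<epsilon> * sqrt X"
    and h2: "4 * real P ^ (2 * K) * real_of_int G ^ 2 \<le> 3 * \<epsilon>\<^sup>2 * X"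
  shows "real (class_total X) \<le> 30 * X + 18 * \<epsilon> * sqrt X ^ 3 +
    (8 / (real_of_int G - 1) + \<delta> + 27 / real K) * real_of_int Y ^ 3"
proof -
  define S0 where "S0 = {(a, b, c). (a::int) = 0 \<and> real_of_int (b\<^sup>2) \<le> 5 * X \<and> 0 \<le> c \<and> c < \<bar>b\<bar>}"
  define S1 where "S1 = {(a, b, c). (a::int) \<noteq> 0 \<and> real_of_int \<bar>a\<bar> \<le> \<epsilon> * sqrt X \<and> \<bar>b\<bar> \<le> \<bar>a\<bar> \<and>
    real_of_int \<bar>b\<^sup>2 - 4 * a * c - 1\<bar> \<le> 4 * X}"
  define S2 where "S2 = {(a, b, c). a \<noteq> 0 \<and> b \<noteq> 0 \<and> c \<noteq> 0 \<and> \<bar>a\<bar> \<le> Y \<and> \<bar>b\<bar> \<le> Y \<and> \<bar>c\<bar> \<le> Y \<and>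
    G \<le> bqf_content (a, b, c)}"
  define S3 where "S3 = (\<lambda>(a, \<beta>, c). (a, 2 * \<beta> + 1, c)) ` unsieved {p. prime p \<and> p \<le> P} {-Y..Y}"
  define S4 where "S4 = {f \<in> all_reps X. \<exists>m S. m \<noteq> 0 \<and> f \<in> reps m \<and> card S = K \<and>
      (\<forall>g\<in>S. zequiv m f g \<and> g \<in> {-Y..Y} \<times> {-Y..Y} \<times> {-Y..Y})}"
  have "3 \<le> (3 + 2 / \<epsilon>) * sqrt X"
    using mult_mono[of 3 "3 + 2 / \<epsilon>" 1 "sqrt X"] X \<epsilon> by simp
  then have Y1: "Y \<ge> 1" unfolding Y by linarith
  have "all_reps X \<subseteq> S0 \<union> S1 \<union> S2 \<union> S3 \<union> S4"
  proof
    fix f assume fX: "f \<in> all_reps X"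
    then obtain m where m: "m \<noteq> 0" "\<bar>real_of_int m\<bar> \<le> X" and f: "f \<in> reps m"
      by (auto simp: all_reps_def)
    obtain a b c where abc: "f = (a, b, c)" by (cases f)
    note min = minimal_rep_bounds[OF minimal_rep_reps[OF m(1) f, unfolded abc]]
    have disc: "b\<^sup>2 - 4 * a * c = 1 - 4 * m" using min(1) by (simp add: bqf_disc_def)
    have "real_of_int \<bar>1 - 4 * m\<bar> \<le> 5 * X" using m X by simp
    note D5 = this[folded disc]
    consider "a = 0" | "a \<noteq> 0" "real_of_int \<bar>a\<bar> \<le> \<epsilon> * sqrt X" | "\<epsilon> * sqrt X < real_of_int \<bar>a\<bar>"
      by linarith
    then show "f \<in> S0 \<union> S1 \<union> S2 \<union> S3 \<union> S4"
    proof cases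
      case 1
      then have "f \<in> S0" using min(3)[OF 1] D5 by (simp add: S0_def abc)
      then show ?thesis by blast
    next
      case 2
      have "\<bar>b\<^sup>2 - 4 * a * c - 1\<bar> = 4 * \<bar>m\<bar>" unfolding disc by (simp add: abs_mult)
      then have "real_of_int \<bar>b\<^sup>2 - 4 * a * c - 1\<bar> = 4 * \<bar>real_of_int m\<bar>" by simp
      then have "f \<in> S1" using 2 min(2)[OF 2(1)] m(2) by (simp add: S1_def abc is_reduced_def)
      then show ?thesis by blast
    next
      case 3
      have "\<epsilon> * sqrt X > 0" using \<epsilon> X by simp
      then have a0: "a \<noteq> 0" using 3 by auto
      note red = min(2)[OF a0]
      have c3: "\<epsilon> * sqrt X < real_of_int \<bar>c\<bar>" using 3 red unfolding is_reduced_def by auto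
      have b0: "b \<noteq> 0" using disc_odd[OF min(1)] by auto
      note rb = is_reduced_bounds[OF red, unfolded bqf_disc_def prod.case]
      have "(a, b, c) \<in> {-Y..Y} \<times> {-Y..Y} \<times> {-Y..Y}"
      proof (rule box_mem[OF X \<epsilon>(1) 3 c3 _ _ Y])
        show "real_of_int (3 * (\<bar>a\<bar> * \<bar>c\<bar>)) \<le> 5 * X"
          using D5 of_int_le_iff[where 'a = real, THEN iffD2, OF rb(1)] by linarith
        have "b\<^sup>2 \<le> \<bar>b\<^sup>2 - 4 * a * c\<bar>" using rb(2,3) zero_le_power2[of a] by linarith
        from of_int_le_iff[where 'a = real, THEN iffD2, OF this]
        show "real_of_int (b\<^sup>2) \<le> 5 * X" using D5 by linarith
      qed
      then have box: "\<bar>a\<bar> \<le> Y" "\<bar>b\<bar> \<le> Y" "\<bar>c\<bar> \<le> Y" by auto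
      show ?thesis
      proof (cases "G \<le> bqf_content (a, b, c)")
        case True
        then have "f \<in> S2" using a0 b0 rb(4) box by (simp add: S2_def abc)
        then show ?thesis by blast
      next
        case False
        show ?thesis
        \<comment> \<open>Negative m need no small prime factor, since the river serves
          them.\<close>
        proof (cases "m > 0 \<and> \<not> (\<exists>p. prime p \<and> p \<le> P \<and> int p dvd m)")
          case True
          obtain \<beta> where \<beta>: "b = 2 * \<beta> + 1" using disc_odd[OF min(1)] by (elim oddE)
          have "sieve_form (a, \<beta>, c) = m"
            using disc by (simp add: sieve_form_def \<beta> power2_eq_square algebra_simps)
          then have "(a, \<beta>, c) \<in> unsieved {p. prime p \<and> p \<le> P} {-Y..Y}"
            using True box \<beta> by (auto simp: unsieved_def)
          then have "f \<in> S3" unfolding S3_def abc \<beta> by (rule rev_image_eqI) simp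
          then show ?thesis by blast
        next
          case no: False
          have "\<exists>S. card S = K \<and> (\<forall>g\<in>S. zequiv m (a, b, c) g \<and> g \<in> {-Y..Y} \<times> {-Y..Y} \<times> {-Y..Y})"
            by (rule reps_many[OF m X \<epsilon>(1) Y f[unfolded abc] 3 _ _ h1 h2]) (use False no in auto)
          then have "f \<in> S4" using fX f m(1) unfolding S4_def abc by blast
          then show ?thesis by blast
        qed
      qed
    qed
  qed
  moreover have fin: "finite S0" "finite S1" "finite S2" "finite S3" "finite S4"
    using card_isotropic_forms(1)[OF X] card_small_lead(1)[OF X \<epsilon>] card_large_content(1)[OF G, of Y] Y1
      finite_all_reps[of X]
    by (simp_all add: S0_def S1_def S2_def S3_def S4_def finite_unsieved)
  ultimately have "card (all_reps X) \<le> card (S0 \<union> S1 \<union> S2 \<union> S3 \<union> S4)"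
    by (intro card_mono) auto
  also have "\<dots> \<le> card S0 + card S1 + card S2 + card S3 + card S4"
    using card_Un_le[of "S0 \<union> S1 \<union> S2 \<union> S3" S4] card_Un_le[of "S0 \<union> S1 \<union> S2" S3]
      card_Un_le[of "S0 \<union> S1" S2] card_Un_le[of S0 S1] by linarith
  finally have "real (class_total X) \<le> real (card S0) + real (card S1) + real (card S2) + real (card S3) + real (card S4)"
    unfolding class_total_eq_card by linarith
  moreover have "real (card S0) \<le> 30 * X" unfolding S0_def by (rule card_isotropic_forms(2)[OF X])
  moreover have "real (card S1) \<le> 18 * \<epsilon> * sqrt X ^ 3" unfolding S1_def by (rule card_small_lead(2)[OF X \<epsilon>])
  moreover have "real (card S2) \<le> 8 * real_of_int Y ^ 3 / (real_of_int G - 1)"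
    unfolding S2_def by (rule card_large_content(2)[OF G]) (use Y1 in simp)
  moreover have "real (card S3) \<le> \<delta> * real_of_int Y ^ 3"
  proof -
    have "card S3 \<le> card (unsieved {p. prime p \<and> p \<le> P} {-Y..Y})"
      unfolding S3_def by (rule card_image_le) (simp add: finite_unsieved)
    then show ?thesis using sieve by linarith
  qed
  moreover have "real (card S4) \<le> 27 / real K * real_of_int Y ^ 3"
  proof -
    have "K * card S4 \<le> nat (2 * Y + 1) ^ 3"
      by (rule card_reps_many[OF fin(5)]) (unfold S4_def mem_Collect_eq, elim conjE)
    then have "real K * real (card S4) \<le> real (nat (2 * Y + 1)) ^ 3"
      by (metis of_nat_le_iff of_nat_mult of_nat_power)
    \<comment> \<open>Here \<open>Y \<ge> 1\<close> absorbs the 1 in \<open>2 * Y + 1\<close>; this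
      is the source of the 27.\<close>
    also have "\<dots> \<le> (3 * real_of_int Y) ^ 3" using Y1 by (intro power_mono) auto
    also have "\<dots> = 27 * real_of_int Y ^ 3" by (simp add: power_mult_distrib)
    finally show ?thesis using K by (simp add: field_simps)
  qed
  ultimately show ?thesis by (simp add: algebra_simps)
qed

text \<open>Each of the five contributions gets \<open>\<eta> / 5\<close>, whence 90, 40, 135 and
  150 as 5 times 18, 8, 27 and 30; \<open>C ^ 3\<close> compensates for the side of the cube. The
  order of choice matters: \<open>\<epsilon>\<close>, \<open>G\<close>, \<open>\<delta>\<close>,
  \<open>K\<close> depend on \<open>\<eta>\<close> only, then \<open>\<delta>\<close> fixes P and
  \<open>Y0\<close>, and X is taken large last.\<close>

lemma class_total_eventually_le:
  assumes \<eta>: "\<eta> > 0"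
  shows "\<forall>\<^sub>F X in at_top. real (class_total X) \<le> \<eta> * sqrt X ^ 3"
proof -
  define \<epsilon> where "\<epsilon> = min 1 (\<eta> / 90)"
  define C where "C = 3 + 2 / \<epsilon>"
  define G where "G = \<lceil>40 * C ^ 3 / \<eta>\<rceil> + 2"
  define \<delta> where "\<delta> = \<eta> / (5 * C ^ 3)"
  define K where "K = nat \<lceil>135 * C ^ 3 / \<eta>\<rceil> + 1"
  have \<epsilon>: "0 < \<epsilon>" "\<epsilon> \<le> 1" "18 * \<epsilon> \<le> \<eta> / 5" using \<eta> by (simp_all add: \<epsilon>_def)
  have C: "C > 0" using \<epsilon> by (simp add: C_def add_pos_pos)
  have pos: "40 * C ^ 3 / \<eta> > 0" "135 * C ^ 3 / \<eta> > 0" using C \<eta> by simp_all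
  have G: "G \<ge> 2" "40 * C ^ 3 / \<eta> \<le> real_of_int G - 1"
    using pos(1) by (simp_all add: G_def) linarith+
  have K: "K > 0" "135 * C ^ 3 / \<eta> \<le> real K" by (simp_all add: K_def) linarith+
  have \<delta>: "\<delta> > 0" using \<eta> C by (simp add: \<delta>_def)
  from unsieved_box[OF \<delta>] obtain P Y0 where
    P: "\<forall>Y\<ge>Y0. real (card (unsieved {p. prime p \<and> p \<le> P} {-Y..Y})) \<le> \<delta> * real_of_int Y ^ 3"
    by (elim exE)
  have bound: "real (class_total X) \<le> \<eta> * sqrt X ^ 3"
    if X: "X \<ge> 1" "150 / \<eta> \<le> sqrt X" "real_of_int Y0 \<le> sqrt X"
      "2 ^ K * real_of_int G / \<epsilon> \<le> sqrt X" "4 * real P ^ (2 * K) * real_of_int G ^ 2 / (3 * \<epsilon>\<^sup>2) \<le> X" for X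
  proof -
    define s where "s = sqrt X"
    define Y where "Y = \<lfloor>C * s\<rfloor>"
    have s: "s \<ge> 1" "s * s = X" using X by (simp_all add: s_def)
    have C1: "C \<ge> 1" using \<epsilon> by (simp add: C_def)
    have "1 * s \<le> C * s" using C1 s(1) by (intro mult_right_mono) simp_all
    then have "real_of_int Y0 \<le> C * s" using X(3) unfolding s_def by linarith
    then have "Y \<ge> Y0" by (simp add: Y_def le_floor_iff)
    note sieve = P[rule_format, OF this]
    have Y: "0 \<le> real_of_int Y" "real_of_int Y \<le> C * s" using C s by (simp_all add: Y_def)
    have Y3: "real_of_int Y ^ 3 \<le> C ^ 3 * s ^ 3"
      using power_mono[OF Y(2,1), of 3] by (simp add: power_mult_distrib)
    have Yeq: "Y = \<lfloor>(3 + 2 / \<epsilon>) * sqrt X\<rfloor>" by (simp add: Y_def C_def s_def)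
    have h1: "2 ^ K * real_of_int G \<le> \<epsilon> * sqrt X" using X(4) \<epsilon>(1) by (simp add: field_simps)
    have h2: "4 * real P ^ (2 * K) * real_of_int G ^ 2 \<le> 3 * \<epsilon>\<^sup>2 * X"
      using X(5) \<epsilon>(1) by (simp add: field_simps)
    have "real (class_total X) \<le> 30 * X + 18 * \<epsilon> * s ^ 3 +
      (8 / (real_of_int G - 1) + \<delta> + 27 / real K) * real_of_int Y ^ 3"
      unfolding s_def by (rule class_total_le[OF X(1) \<epsilon>(1,2) Yeq G(1) K(1) sieve h1 h2])
    also have "\<dots> \<le> \<eta> / 5 * s ^ 3 + \<eta> / 5 * s ^ 3 + (3 * (\<eta> / (5 * C ^ 3))) * (C ^ 3 * s ^ 3)"
    proof (rule add_mono[OF add_mono])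
      have "150 \<le> \<eta> * s" using X(2) \<eta> by (simp add: s_def pos_divide_le_eq mult.commute)
      then have "30 \<le> \<eta> / 5 * s" by simp
      then have "30 * (s * s) \<le> (\<eta> / 5 * s) * (s * s)" using s(1) by (intro mult_right_mono) simp_all
      then show "30 * X \<le> \<eta> / 5 * s ^ 3"
        unfolding s(2)[symmetric] by (simp add: power3_eq_cube mult.assoc)
      show "18 * \<epsilon> * s ^ 3 \<le> \<eta> / 5 * s ^ 3"
        using \<epsilon>(3) s(1) by (intro mult_right_mono) simp_all
      have "8 / (real_of_int G - 1) \<le> \<eta> / (5 * C ^ 3)"
      proof -
        have "real_of_int G - 1 > 0" using G(1) by simp
        then show ?thesis using G(2) C \<eta> by (simp add: field_simps)
      qed
      moreover have "27 / real K \<le> \<eta> / (5 * C ^ 3)"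
        using K C \<eta> by (simp add: field_simps)
      ultimately have "8 / (real_of_int G - 1) + \<delta> + 27 / real K \<le> 3 * (\<eta> / (5 * C ^ 3))"
        unfolding \<delta>_def by linarith
      then show "(8 / (real_of_int G - 1) + \<delta> + 27 / real K) * real_of_int Y ^ 3 \<le>
          3 * (\<eta> / (5 * C ^ 3)) * (C ^ 3 * s ^ 3)"
        by (rule mult_mono) (use Y3 Y(1) C \<eta> in simp_all)
    qed
    also have "\<dots> = \<eta> * s ^ 3" using C by (simp add: field_simps)
    finally show ?thesis by (simp add: s_def)
  qed
  have ev: "\<forall>\<^sub>F X in at_top. c \<le> sqrt X" for c
    using sqrt_at_top by (simp add: filterlim_at_top)
  show ?thesis
    using eventually_ge_at_top[of 1] ev[of "150 / \<eta>"] ev[of "real_of_int Y0"]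
      ev[of "2 ^ K * real_of_int G / \<epsilon>"]
      eventually_ge_at_top[of "4 * real P ^ (2 * K) * real_of_int G ^ 2 / (3 * \<epsilon>\<^sup>2)"]
    by eventually_elim (rule bound)
qed

theorem theorem5p1:
  shows "(\<forall>m::int. m \<noteq> 0 \<longrightarrow> finite (SL2_classes (Z_inv m) (of_int (1 - 4 * m)))) \<and>
    ((\<lambda>X::real. real (class_total X) / X powr (3 / 2)) \<longlongrightarrow> 0) at_top"
proof
  show "\<forall>m::int. m \<noteq> 0 \<longrightarrow> finite (SL2_classes (Z_inv m) (of_int (1 - 4 * m)))"
    by (intro allI impI finite_classes)
  show "((\<lambda>X::real. real (class_total X) / X powr (3 / 2)) \<longlongrightarrow> 0) at_top"
  proof (rule tendstoI)
    fix e :: real assume "e > 0"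
    then have "e / 2 > 0" by simp
    from class_total_eventually_le[OF this] eventually_gt_at_top[of 0]
    show "\<forall>\<^sub>F X in at_top. dist (real (class_total X) / X powr (3 / 2)) 0 < e"
    proof eventually_elim
      case (elim X)
      have "X powr (3 / 2) = (X powr (1 / 2)) powr 3" by (simp add: powr_powr)
      also have "\<dots> = sqrt X ^ 3" using elim(2) by (simp add: powr_half_sqrt powr_numeral)
      finally have "X powr (3 / 2) = sqrt X ^ 3" .
      moreover have "sqrt X ^ 3 > 0" using elim(2) by simp
      moreover have "real (class_total X) < e * sqrt X ^ 3"
      proof -
        have "e / 2 * sqrt X ^ 3 < e * sqrt X ^ 3"
          using \<open>e > 0\<close> \<open>sqrt X ^ 3 > 0\<close> by (intro mult_strict_right_mono) simp_all
        with elim(1) show ?thesis by linarith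
      qed
      ultimately show ?case by (simp add: dist_real_def pos_divide_less_eq)
    qed
  qed
qed

end
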